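(* Consider the B-ary Tree Push-Pull (BTPP) iteration on $n$ agents with branch size $B$, tree diameter $d$, common initial point $x_i^{(0)}=x^{(0)}\in\mathbb R^p$ for all $i$, and stochastic gradients satisfying: (i) for all $i$ and $x$, the gradient estimators are unbiased, $\mathbb E[g_i(x,\xi_i)\mid x]=\nabla f_i(x)$, with variance $\mathbb E[\|g_i(x,\xi_i)-\nabla f_i(x)\|^2\mid x]\le\sigma^2$, the samples being independent; (ii) each $f_i$ is lower bounded with $L$-Lipschitz continuous gradient. Let $T$ be a positive integer, $\Delta_f:=f(x_1^{(0)})-f^*$, and let the stepsize be $$\gamma=\min\left\{\left(\frac{\Delta_f}{3\sigma^2Ln(T+1)}\right)^{1/2},\ \left(\frac{\Delta_f}{1500\,n^2d^6\sigma^2L^2(T+1)}\right)^{1/3},\ \frac{1}{100\,nd^3L}\right\}.$$ Then $$\frac1{T+1}\sum_{t=0}^{T}\mathbb E\|\nabla f(x_1^{(t)})\|_2^2\le\frac{32\sqrt{\Delta_f\sigma^2L}}{\sqrt{n(T+1)}}+\frac{240\,d^2(\sigma^2L^2\Delta_f^2)^{1/3}}{(\sqrt n\,(T+1))^{2/3}}+\frac{800\,d^3L\Delta_f}{T+1}+\frac{\|\nabla\mathbf F(\mathbf X^{(0)})\|_F^2}{n(T+1)}.$$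
   Context: Trees: $B\ge2$, $n\ge2$ are integers and $d$ is the unique integer with $\frac{B^d-1}{B-1}<n\le\frac{B^{d+1}-1}{B-1}$ (the diameter/depth of the B-ary tree on $n$ nodes, indexed layer by layer from root $1$; $d\ge1$). $\mathcal R\in\mathbb R^{n\times n}$ has $\mathcal R_{ij}=1$ if $B(j-1)+2\le i\le Bj+1$ (with $i\le n$) or $i=j=1$, and $\mathcal R_{ij}=0$ otherwise; $\mathcal C=\mathcal R^\top$. Problem: $f_i:\mathbb R^p\to\mathbb R$ ($i=1,\dots,n$) are differentiable, $f=\frac1n\sum_{i=1}^nf_i$, $f^*=\min_{x}f(x)$. Agent $i$ has a stochastic gradient $g_i(x,\xi_i)$ with $\xi_i\sim\mathcal D_i$; the samples $\xi_i^{(t)}\sim\mathcal D_i$ are independent over all agents $i$ and all times $t$. Constants $\sigma^2>0$, $L>0$. BTPP algorithm: with $\mathbf X^{(t)}=[x_1^{(t)},\dots,x_n^{(t)}]^\top$, $\mathbf Y^{(t)}=[y_1^{(t)},\dots,y_n^{(t)}]^\top\in\mathbb R^{n\times p}$, $\mathbf G^{(t)}=[g_1(x_1^{(t)},\xi_1^{(t)}),\dots,g_n(x_n^{(t)},\xi_n^{(t)})]^\top$, start from deterministic $\mathbf X^{(0)}$ with all rows equal to $x^{(0)\top}$, $\mathbf Y^{(0)}=\mathbf G^{(0)}$, and for $t\ge0$ $$\mathbf X^{(t+1)}=\mathcal R(\mathbf X^{(t)}-\gamma\mathbf Y^{(t)}),\qquad \mathbf Y^{(t+1)}=\mathcal C\mathbf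 Y^{(t)}+\mathbf G^{(t+1)}-\mathbf G^{(t)}.$$ $\nabla\mathbf F(\mathbf X)=[\nabla f_1(x_1),\dots,\nabla f_n(x_n)]^\top\in\mathbb R^{n\times p}$; $\|\cdot\|_F$ is the Frobenius norm. *)

theory Defs
  imports "HOL-Probability.Probability"
begin

text \<open>
  Agents are numbered \<open>1, \<dots>, n\<close> as in the B-ary tree (layer by layer, root \<open>1\<close>).  An
  \<open>n \<times> n\<close> matrix is a function \<open>nat \<Rightarrow> nat \<Rightarrow> real\<close> of which only the entries with
  indices in \<open>{1..n}\<close> matter, and an \<open>n \<times> p\<close> matrix is the family of its rows in
  \<open>real ^ 'p\<close>.
\<close>

definition treeR :: "nat \<Rightarrow> nat \<Rightarrow> nat \<Rightarrow> real" where
  "treeR B i j =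
     (if (B * (j - 1) + 2 \<le> i \<and> i \<le> B * j + 1) \<or> (i = 1 \<and> j = 1) then 1 else 0)"

definition treeC :: "nat \<Rightarrow> nat \<Rightarrow> nat \<Rightarrow> real" where
  "treeC B i j = treeR B j i"

definition mat_rows_mult ::
    "nat \<Rightarrow> (nat \<Rightarrow> nat \<Rightarrow> real) \<Rightarrow> (nat \<Rightarrow> real ^ 'p) \<Rightarrow> nat \<Rightarrow> real ^ 'p" where
  "mat_rows_mult n A Z i = (\<Sum>j=1..n. A i j *\<^sub>R Z j)"

definition frobenius_norm :: "nat \<Rightarrow> (nat \<Rightarrow> real ^ 'p) \<Rightarrow> real" where
  "frobenius_norm n Z = sqrt (\<Sum>i=1..n. \<Sum>k\<in>UNIV. (Z i $ k)\<^sup>2)"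

definition gradient :: "('a::real_inner \<Rightarrow> real) \<Rightarrow> 'a \<Rightarrow> 'a" where
  "gradient f x = (THE D. GDERIV f x :> D)"

lemma gradient_eqI:
  assumes "GDERIV f x :> D"
  shows "gradient f x = D"
  unfolding gradient_def
proof (rule the_equality)
  fix D' assume "GDERIV f x :> D'"
  then have "(\<lambda>h. inner h D') = (\<lambda>h. inner h D)"
    using assms unfolding gderiv_def by (rule has_derivative_unique)
  then have "inner (D' - D) D' = inner (D' - D) D"
    by (rule fun_cong)
  then have "inner (D' - D) (D' - D) = 0"
    by (simp add: inner_diff_right)
  then show "D' = D" by simp
qed (rule assms)

lemma GDERIV_gradient:
  fixes f :: "'a::euclidean_space \<Rightarrow> real"
  assumes "f differentiable (at x)"
  shows "GDERIV f x :> gradient f x"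
proof -
  obtain f' where f': "(f has_derivative f') (at x)"
    using assms unfolding differentiable_def by blast
  interpret bounded_linear f' using f' by (rule has_derivative_bounded_linear)
  have "f' h = inner h (\<Sum>b\<in>Basis. f' b *\<^sub>R b)" for h
  proof -
    have "f' h = f' (\<Sum>b\<in>Basis. inner h b *\<^sub>R b)" by (simp add: euclidean_representation)
    also have "\<dots> = (\<Sum>b\<in>Basis. inner h b * f' b)" by (simp add: sum scaleR)
    finally show ?thesis by (simp add: inner_sum_right mult.commute)
  qed
  then have "f' = (\<lambda>h. inner h (\<Sum>b\<in>Basis. f' b *\<^sub>R b))"
    by (rule ext)
  with f' have "GDERIV f x :> (\<Sum>b\<in>Basis. f' b *\<^sub>R b)"
    unfolding gderiv_def by (rule subst[where P="\<lambda>F. (f has_derivative F) (at x)", rotated])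
  then show ?thesis by (simp add: gradient_eqI)
qed

definition avg_objective :: "nat \<Rightarrow> (nat \<Rightarrow> 'a \<Rightarrow> real) \<Rightarrow> 'a \<Rightarrow> real" where
  "avg_objective n f x = (1 / real n) * (\<Sum>i=1..n. f i x)"

text \<open>
  The BTPP recursion along one realisation of the samples: \<open>s i t\<close> is the sample drawn by
  agent \<open>i\<close> at time \<open>t\<close>, and the value at \<open>t\<close> is the family of rows of
  \<open>\<^bold>X\<close>, \<open>\<^bold>Y\<close> at that time.
\<close>

function btppX btppY ::
    "nat \<Rightarrow> nat \<Rightarrow> real \<Rightarrow> (nat \<Rightarrow> real ^ 'p \<Rightarrow> 's \<Rightarrow> real ^ 'p) \<Rightarrow> real ^ 'p
      \<Rightarrow> (nat \<Rightarrow> nat \<Rightarrow> 's) \<Rightarrow> nat \<Rightarrow> nat \<Rightarrow> real ^ 'p" where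
  "btppX n B \<gamma> g x0 s 0 = (\<lambda>i. x0)"
| "btppX n B \<gamma> g x0 s (Suc t) =
     mat_rows_mult n (treeR B)
       (\<lambda>j. btppX n B \<gamma> g x0 s t j - \<gamma> *\<^sub>R btppY n B \<gamma> g x0 s t j)"
| "btppY n B \<gamma> g x0 s 0 = (\<lambda>i. g i (btppX n B \<gamma> g x0 s 0 i) (s i 0))"
| "btppY n B \<gamma> g x0 s (Suc t) =
     (\<lambda>i. mat_rows_mult n (treeC B) (btppY n B \<gamma> g x0 s t) i
          + g i (btppX n B \<gamma> g x0 s (Suc t) i) (s i (Suc t))
          - g i (btppX n B \<gamma> g x0 s t i) (s i t))"
  by pat_completeness auto
termination
  by (relation "Wellfounded.measure (\<lambda>a. case a of
        Inl (n, B, \<gamma>, g, x0, s, t) \<Rightarrow> 2 * t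
      | Inr (n, B, \<gamma>, g, x0, s, t) \<Rightarrow> 2 * t + 1)") auto

end

theory Submission
  imports Defs
begin

text \<open>
  Write \<open>h j t\<close> for the stochastic gradient that agent \<open>j\<close> draws at time \<open>t - depth j\<close> (and \<open>0\<close> before
  that). Since the tracking matrix moves every gradient one level up per round, the telescoping sums
  collapse and the root performs \<open>x(t+1) = x(t) - \<gamma> (\<Sum>j. h j t)\<close>: stochastic gradient descent with stepsize
  \<open>\<gamma> n\<close>, evaluated at the delayed points \<open>Z j t\<close>, the iterate of agent \<open>j\<close> at time \<open>t - depth j\<close>. The
  point \<open>Z j t\<close> differs from the root iterate by a short root increment and by the differences
  \<open>h l s - h l (s-1)\<close> summed over the subtrees hanging at the path to \<open>j\<close>, so for \<open>\<gamma> n d\<^sup>3 L \<le> 1/100\<close> the total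
  error can be absorbed along each sample path, up to a linear combination of the squared norms of
  noise sums over subtrees. One expectation finishes the descent argument: information from agent \<open>j\<close>
  needs \<open>depth j\<close> rounds to reach the root, hence the noise in \<open>h j t\<close> is centred given \<open>x(t)\<close> and given
  the noise of the other agents in \<open>h l t\<close>.
\<close>

section \<open>The tree\<close>

text \<open>The error quantities bound each other in a circle: delayed points deviate because the
  root and the trackers move, and trackers move because points deviate. What breaks the circle is
  that every feedback coefficient is a multiple of \<open>\<kappa>\<close> or of
  \<open>L * \<gamma> * n\<close>, both small by the choice of the stepsize. A second obstacle is
  the depth of the tree: deviations are inherited edge by edge, and splitting squares with fixed
  weights would cost a factor exponential in \<open>d\<close>. Weights that depend on the level
  multiply to a factor linear in the depth. A third one is the start: for up to \<open>d\<close>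
  rounds the root lacks the gradients of deep agents, which produces the term with the initial
  gradients. Finally, samples are ordered by shifted time, that is drawing time plus depth. Noises
  of different agents at equal shifted time are then orthogonal, so the noise sum over a subtree has
  second moment of order \<open>n\<close> and not of order \<open>n\<close> squared.\<close>

fun parent :: "nat \<Rightarrow> nat \<Rightarrow> nat" where
  "parent B i = (if i \<le> 1 then 1 else (i - 2) div B + 1)"

declare parent.simps [simp del]

lemma parent_root [simp]: "parent B (Suc 0) = Suc 0"
  by (simp add: parent.simps)

lemma parent_ge_1: "1 \<le> parent B i"
  by (simp add: parent.simps)

lemma parent_less: "parent B i < i" if "1 < i"
proof -
  have "(i - 2) div B \<le> i - 2" by (rule div_le_dividend)
  then have "(i - 2) div B + 1 < i" using that by linarith
  then show ?thesis using that by (simp add: parent.simps)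
qed

lemma parent_in: "i \<in> {1..n} \<Longrightarrow> parent B i \<in> {1..n}"
  using parent_less[of i B] parent_ge_1[of B i] by (cases "i = 1") auto

function depth :: "nat \<Rightarrow> nat \<Rightarrow> nat" where
  "depth B i = (if i \<le> 1 then 0 else Suc (depth B (parent B i)))"
  by pat_completeness auto
termination
  by (relation "Wellfounded.measure snd") (auto intro: parent_less)

declare depth.simps [simp del]

lemma depth_root [simp]: "depth B (Suc 0) = 0"
  by (simp add: depth.simps)

lemma depth_parent: "1 < i \<Longrightarrow> depth B i = Suc (depth B (parent B i))"
  by (subst depth.simps) simp

lemma depth_pos: "1 < i \<Longrightarrow> 0 < depth B i"
  by (simp add: depth_parent)

lemma depth_eq_0_iff: "1 \<le> i \<Longrightarrow> depth B i = 0 \<longleftrightarrow> i = 1"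
  using depth_pos[of i B] by (cases "i = 1") auto

text \<open>The bound counts the nodes in layers \<open>0\<close> to \<open>k\<close> of the full
  tree, and passing to the parent removes one layer from that count.\<close>

lemma depth_le_of_le_geometric:
  assumes B: "B \<ge> 2" and "real i \<le> (real B ^ (k + 1) - 1) / (real B - 1)"
  shows "depth B i \<le> k"
  using assms(2)
proof (induction k arbitrary: i)
  case 0
  then show ?case using B by (simp add: depth.simps)
next
  case (Suc k)
  show ?case
  proof (cases "i \<le> 1")
    case False
    let ?N = "\<Sum>m\<le>k. B ^ m"
    have N: "real (\<Sum>m\<le>k. B ^ m) = (real B ^ (k + 1) - 1) / (real B - 1)" for k
      using B geometric_sum[of "real B" "Suc k"] by (simp add: lessThan_Suc_atMost del: sum.lessThan_Suc)
    have "real i \<le> real (\<Sum>m\<le>Suc k. B ^ m)"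
      using Suc.prems N[of "Suc k"] by simp
    then have "i \<le> (\<Sum>m\<le>Suc k. B ^ m)" using of_nat_le_iff by blast
    then have "i \<le> 1 + B * ?N"
      by (simp add: sum.atMost_Suc_shift sum_distrib_left del: sum.atMost_Suc)
    \<comment> \<open>Below the root the nodes come in blocks of \<open>B\<close>, one block per
      parent, so the first \<open>1 + B * ?N\<close> nodes have their parents among the first
      \<open>?N\<close>.\<close>
    then have "i - 2 < B * ?N" using False by linarith
    then have "(i - 2) div B < ?N" using B
      by (simp add: less_mult_imp_div_less mult.commute)
    then have "parent B i \<le> ?N" using False by (simp add: parent.simps)
    then have "real (parent B i) \<le> (real B ^ (k + 1) - 1) / (real B - 1)"
      using N[of k] of_nat_le_iff[of "parent B i" ?N, where ?'a=real] by simp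
    then show ?thesis using Suc.IH False depth_parent[of i B] by simp
  qed (simp add: depth.simps)
qed

section \<open>Ancestors and subtrees\<close>

function ancestor :: "nat \<Rightarrow> nat \<Rightarrow> nat \<Rightarrow> bool" where
  "ancestor B a l \<longleftrightarrow> a = l \<or> (if 1 < l then ancestor B a (parent B l) else False)"
  by pat_completeness auto
termination
  by (relation "Wellfounded.measure (\<lambda>(B, a, l). l)") (auto intro: parent_less)

declare ancestor.simps [simp del]

lemma ancestor_iff: "ancestor B a l \<longleftrightarrow> a = l \<or> (1 < l \<and> ancestor B a (parent B l))"
  by (subst ancestor.simps) simp

lemma ancestor_refl [simp]: "ancestor B a a"
  by (subst ancestor_iff) simp

lemma ancestor_Suc_0 [simp]: "ancestor B a (Suc 0) \<longleftrightarrow> a = Suc 0"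
  by (subst ancestor_iff) simp

lemma ancestor_root: "1 \<le> l \<Longrightarrow> ancestor B (Suc 0) l"
proof (induction l rule: less_induct)
  case (less l)
  then show ?case
    using parent_less[of l B] parent_ge_1[of B l] by (subst ancestor_iff) (cases "l = 1"; force)
qed

lemma ancestor_le: "1 \<le> l \<Longrightarrow> ancestor B a l \<Longrightarrow> a \<le> l"
proof (induction l rule: less_induct)
  case (less l)
  from less.prems show ?case
    using less.IH[of "parent B l"] parent_less[of l B] parent_ge_1[of B l] by (subst (asm) ancestor_iff) force
qed

lemma depth_less_of_ancestor: "1 \<le> l \<Longrightarrow> ancestor B a l \<Longrightarrow> a \<noteq> l \<Longrightarrow> depth B a < depth B l"
proof (induction l rule: less_induct)
  case (less l)
  then have "1 < l" "ancestor B a (parent B l)" by (auto simp: ancestor_iff[of B a l])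
  then show ?case
    using less.IH[of "parent B l"] parent_less[of l B] parent_ge_1[of B l] depth_parent[of l B] by fastforce
qed

definition children :: "nat \<Rightarrow> nat \<Rightarrow> nat \<Rightarrow> nat set" where
  "children n B a = {c \<in> {2..n}. parent B c = a}"

definition subtree :: "nat \<Rightarrow> nat \<Rightarrow> nat \<Rightarrow> nat set" where
  "subtree n B a = {l \<in> {1..n}. ancestor B a l}"

lemma finite_children [simp]: "finite (children n B a)"
  and finite_subtree [simp]: "finite (subtree n B a)"
  by (simp_all add: children_def subtree_def)

lemma subtree_subset: "subtree n B a \<subseteq> {1..n}"
  by (auto simp: subtree_def)

lemma subtree_root: "subtree n B (Suc 0) = {1..n}"
  by (auto simp: subtree_def intro!: ancestor_root)

text \<open>The path from \<open>l\<close> up to \<open>a\<close> enters \<open>a\<close> through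
  exactly one child unless \<open>l = a\<close>. With indicators, covering and disjointness of the
  child subtrees are one identity.\<close>

lemma sum_children_ancestor:
  assumes "a \<ge> 1" "l \<in> {1..n}"
  shows "of_bool (ancestor B a l) = of_bool (a = l) + (\<Sum>c\<in>children n B a. of_bool (ancestor B c l) :: real)"
  using assms(2)
proof (induction l rule: less_induct)
  case (less l)
  show ?case
  proof (cases "l = 1")
    case True
    have "\<not> ancestor B c (Suc 0)" if "c \<in> children n B a" for c
      using that ancestor_le[of "Suc 0" B c] by (auto simp: children_def)
    then show ?thesis using True by simp
  next
    case False
    then have l: "1 < l" using less.prems by auto
    let ?p = "parent B l"
    have IH: "of_bool (ancestor B a ?p) =
        of_bool (a = ?p) + (\<Sum>c\<in>children n B a. of_bool (ancestor B c ?p) :: real)"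
      using less.IH[of ?p] parent_less[OF l, of B] parent_in[OF less.prems] by blast
    \<comment> \<open>This makes the two ways of being an ancestor of \<open>l\<close>, being
      \<open>l\<close> or being an ancestor of its parent, mutually exclusive, so that their
      indicators add.\<close>
    have np: "\<not> ancestor B l ?p"
      using ancestor_le[of ?p B l] parent_less[OF l, of B] parent_ge_1[of B l] by auto
    have *: "of_bool (ancestor B c l) = of_bool (c = l) + (of_bool (ancestor B c ?p) :: real)" for c
      using l np by (auto simp: ancestor_iff[of B c l])
    have "(\<Sum>c\<in>children n B a. of_bool (c = l) :: real) = of_bool (l \<in> children n B a)"
      by (simp add: of_bool_def)
    also have "\<dots> = of_bool (a = ?p)"
      using less.prems l by (auto simp: children_def)
    finally show ?thesis
      using * IH by (simp add: sum.distrib)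
  qed
qed

lemma sum_subtree:
  fixes v :: "nat \<Rightarrow> 'a::real_vector"
  assumes "a \<in> {1..n}"
  shows "(\<Sum>l\<in>subtree n B a. v l) = v a + (\<Sum>c\<in>children n B a. \<Sum>l\<in>subtree n B c. v l)"
proof -
  have sub: "(\<Sum>l\<in>subtree n B c. v l) = (\<Sum>l\<in>{1..n}. of_bool (ancestor B c l) *\<^sub>R v l)" for c
    by (simp add: subtree_def of_bool_def if_distrib[of "\<lambda>b. b *\<^sub>R _"] sum.If_cases
        Int_def cong: if_cong)
  have "(\<Sum>l\<in>subtree n B a. v l) =
      (\<Sum>l\<in>{1..n}. of_bool (a = l) *\<^sub>R v l) +
      (\<Sum>l\<in>{1..n}. (\<Sum>c\<in>children n B a. of_bool (ancestor B c l)) *\<^sub>R v l)"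
    unfolding sub sum.distrib[symmetric] scaleR_left_distrib[symmetric]
    using assms sum_children_ancestor[of a _ n B] by (intro sum.cong refl) (simp only: atLeastAtMost_iff)
  also have "(\<Sum>l\<in>{1..n}. of_bool (a = l) *\<^sub>R v l) = v a"
    using assms by (simp add: of_bool_def if_distrib[of "\<lambda>b. b *\<^sub>R _"] cong: if_cong)
  also have "(\<Sum>l\<in>{1..n}. (\<Sum>c\<in>children n B a. of_bool (ancestor B c l)) *\<^sub>R v l) =
      (\<Sum>c\<in>children n B a. \<Sum>l\<in>subtree n B c. v l)"
    unfolding sub scaleR_left.sum by (rule sum.swap)
  finally show ?thesis .
qed

text \<open>The children of \<open>j\<close> fill the block from \<open>B * (j - 1) + 2\<close> to
  \<open>B * j + 1\<close>; the extra diagonal entry agrees with the convention that the root is its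
  own parent.\<close>

lemma treeR_iff_parent: "1 \<le> i \<Longrightarrow> 1 \<le> j \<Longrightarrow> treeR B i j = of_bool (parent B i = j)" if B: "B \<ge> 1"
proof -
  assume ij: "1 \<le> i" "1 \<le> j"
  have "(B * (j - 1) + 2 \<le> i \<and> i \<le> B * j + 1) \<longleftrightarrow> parent B i = j" if "i \<ge> 2"
  proof -
    define k m where "k = i - 2" and "m = j - 1"
    then have k: "i = k + 2" and m: "j = Suc m"
      using that ij by simp_all
    have "k div B = m \<longleftrightarrow> B * m \<le> k \<and> k < B * Suc m"
      using B dividend_less_times_div[of B k] div_nat_eqI[of B m k]
      by (auto simp: times_div_less_eq_dividend)
    then show ?thesis by (auto simp: k m parent.simps)
  qed
  then show ?thesis using ij by (cases "i = 1") (auto simp: treeR_def parent.simps)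
qed

lemma mat_rows_mult_treeR:
  assumes "B \<ge> 1" "i \<in> {1..n}"
  shows "mat_rows_mult n (treeR B) Z i = Z (parent B i)"
proof -
  have "mat_rows_mult n (treeR B) Z i = (\<Sum>j=1..n. if parent B i = j then Z j else 0)"
    unfolding mat_rows_mult_def
    using assms by (intro sum.cong) (auto simp: treeR_iff_parent)
  then show ?thesis using parent_in[OF assms(2)] by simp
qed

text \<open>Because of the extra diagonal entry the root retains its tracker, whereas every other
  node passes its tracker up and keeps nothing. Hence the root accumulates and the others only carry
  increments.\<close>

lemma mat_rows_mult_treeC:
  assumes "B \<ge> 1" "i \<in> {1..n}"
  shows "mat_rows_mult n (treeC B) Y i = (if i = 1 then Y 1 else 0) + (\<Sum>c\<in>children n B i. Y c)"
proof -
  have "mat_rows_mult n (treeC B) Y i = (\<Sum>c=1..n. if parent B c = i then Y c else 0)"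
    unfolding mat_rows_mult_def treeC_def
    using assms by (intro sum.cong) (auto simp: treeR_iff_parent)
  also have "\<dots> = (\<Sum>c\<in>insert 1 {2..n}. if parent B c = i then Y c else 0)"
    using assms(2) by (intro sum.cong) auto
  also have "\<dots> = (if i = 1 then Y 1 else 0) + (\<Sum>c\<in>{2..n}. if parent B c = i then Y c else 0)"
    by (subst sum.insert) (auto simp: parent.simps)
  also have "(\<Sum>c\<in>{2..n}. if parent B c = i then Y c else 0) = (\<Sum>c\<in>children n B i. Y c)"
    by (simp add: children_def sum.If_cases Int_def)
  finally show ?thesis .
qed

section \<open>The iteration in depth-shifted time\<close>

declare btppX.simps(2) [simp del] btppY.simps(2) [simp del]

context
  fixes n B :: nat and \<gamma> :: real and g :: "nat \<Rightarrow> real ^ 'p \<Rightarrow> 's \<Rightarrow> real ^ 'p"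
    and x0 :: "real ^ 'p"
  assumes B: "B \<ge> 1"
begin

lemma btppX_Suc:
  "i \<in> {1..n} \<Longrightarrow> btppX n B \<gamma> g x0 s (Suc t) i =
    btppX n B \<gamma> g x0 s t (parent B i) - \<gamma> *\<^sub>R btppY n B \<gamma> g x0 s t (parent B i)"
  using B by (simp add: mat_rows_mult_treeR btppX.simps(2))

lemma btppY_Suc:
  "i \<in> {1..n} \<Longrightarrow> btppY n B \<gamma> g x0 s (Suc t) i =
    (if i = 1 then btppY n B \<gamma> g x0 s t 1 else 0) + (\<Sum>c\<in>children n B i. btppY n B \<gamma> g x0 s t c)
     + (g i (btppX n B \<gamma> g x0 s (Suc t) i) (s i (Suc t)) - g i (btppX n B \<gamma> g x0 s t i) (s i t))"
  using B by (simp add: mat_rows_mult_treeC btppY.simps(2))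

text \<open>Truncated subtraction extends the iterate by \<open>x0\<close> to all times before
  \<open>depth B j\<close>.\<close>

definition shiftX :: "(nat \<Rightarrow> nat \<Rightarrow> 's) \<Rightarrow> nat \<Rightarrow> nat \<Rightarrow> real ^ 'p" where
  "shiftX s j t = btppX n B \<gamma> g x0 s (t - depth B j) j"

text \<open>In contrast to \<open>shiftX\<close> the early value is zero, so that the first gradient
  of an agent appears as an ordinary increment, a jump from zero.\<close>

definition shiftG :: "(nat \<Rightarrow> nat \<Rightarrow> 's) \<Rightarrow> nat \<Rightarrow> nat \<Rightarrow> real ^ 'p" where
  "shiftG s j t = (if depth B j \<le> t then g j (shiftX s j t) (s j (t - depth B j)) else 0)"

text \<open>A child lies one level deeper, so its tracker at time \<open>u\<close> refers to the
  same shifted time as the tracker of \<open>a\<close> at time \<open>Suc u\<close>. Child sums and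
  the new increment of \<open>a\<close> then form the subtree sum.\<close>

lemma btppY_nonroot:
  assumes "a \<in> {2..n}"
  shows "btppY n B \<gamma> g x0 s u a =
    (\<Sum>l\<in>subtree n B a. shiftG s l (u + depth B a) - shiftG s l (u + depth B a - 1))"
  using assms
proof (induction u arbitrary: a)
  case 0
  have d: "0 < depth B a" using 0 by (simp add: depth_pos)
  \<comment> \<open>At shifted time \<open>depth B a\<close> only \<open>a\<close> has started
    within its subtree, and one step earlier no node has. Positive depth matters here: otherwise the
    truncated difference would cancel.\<close>
  have "shiftG s l (depth B a) - shiftG s l (depth B a - 1) = (if l = a then g a x0 (s a 0) else 0)"
    if "l \<in> subtree n B a" for l
    using that d depth_less_of_ancestor[of l B a] by (auto simp: subtree_def shiftG_def shiftX_def)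
  then have "(\<Sum>l\<in>subtree n B a. shiftG s l (0 + depth B a) - shiftG s l (0 + depth B a - 1)) =
      (\<Sum>l\<in>subtree n B a. if l = a then g a x0 (s a 0) else 0)"
    by simp
  also have "\<dots> = g a x0 (s a 0)"
    using 0 by (simp add: subtree_def)
  finally show ?case by simp
next
  case (Suc u)
  have a: "a \<in> {1..n}" "a \<noteq> 1" using Suc.prems by auto
  have d: "0 < depth B a" using Suc.prems by (simp add: depth_pos)
  have ch: "c \<in> {2..n}" "depth B c = Suc (depth B a)" if "c \<in> children n B a" for c
    using that depth_parent[of c B] by (auto simp: children_def)
  have "(\<Sum>c\<in>children n B a. btppY n B \<gamma> g x0 s u c) =
      (\<Sum>c\<in>children n B a. \<Sum>l\<in>subtree n B c.
         shiftG s l (Suc u + depth B a) - shiftG s l (Suc u + depth B a - 1))"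
    using ch by (intro sum.cong refl) (simp only: Suc.IH, simp)
  moreover have "shiftG s a (Suc u + depth B a) - shiftG s a (Suc u + depth B a - 1) =
      g a (btppX n B \<gamma> g x0 s (Suc u) a) (s a (Suc u)) - g a (btppX n B \<gamma> g x0 s u a) (s a u)"
    by (simp add: shiftG_def shiftX_def)
  ultimately show ?case
    using a by (simp only: btppY_Suc[OF a(1)] sum_subtree[OF a(1)]) simp
qed

text \<open>Since the root keeps its tracker, the increments received from the whole tree telescope
  in time.\<close>

lemma btppY_root:
  assumes "n \<ge> 1"
  shows "btppY n B \<gamma> g x0 s u 1 = (\<Sum>l=1..n. shiftG s l u)"
proof (induction u)
  case 0
  have "(\<Sum>l=1..n. shiftG s l 0) = (\<Sum>l=1..n. if l = 1 then g 1 x0 (s 1 0) else 0)"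
    by (intro sum.cong) (auto simp: shiftG_def shiftX_def depth_eq_0_iff)
  then show ?case using assms by simp
next
  case (Suc u)
  have 1: "1 \<in> {1..n}" using assms by simp
  have ch: "c \<in> {2..n}" "depth B c = 1" if "c \<in> children n B 1" for c
    using that depth_parent[of c B] by (auto simp: children_def)
  have "(\<Sum>c\<in>children n B 1. btppY n B \<gamma> g x0 s u c) =
      (\<Sum>c\<in>children n B 1. \<Sum>l\<in>subtree n B c. shiftG s l (Suc u) - shiftG s l u)"
    by (intro sum.cong refl) (simp only: btppY_nonroot ch, simp)
  moreover have "shiftG s 1 (Suc u) - shiftG s 1 u =
      g 1 (btppX n B \<gamma> g x0 s (Suc u) 1) (s 1 (Suc u)) - g 1 (btppX n B \<gamma> g x0 s u 1) (s 1 u)"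
    by (simp add: shiftG_def shiftX_def)
  ultimately have "btppY n B \<gamma> g x0 s (Suc u) 1 =
      (\<Sum>l=1..n. shiftG s l u) + (\<Sum>l\<in>subtree n B 1. shiftG s l (Suc u) - shiftG s l u)"
    using Suc by (simp only: btppY_Suc[OF 1] sum_subtree[OF 1]) simp
  also have "\<dots> = (\<Sum>l=1..n. shiftG s l (Suc u))"
    by (simp add: subtree_root sum_subtractf)
  finally show ?case .
qed

lemma shiftX_early: "t \<le> depth B j \<Longrightarrow> shiftX s j t = x0"
  by (simp add: shiftX_def)

lemma shiftX_root_Suc:
  assumes "n \<ge> 1"
  shows "shiftX s 1 (Suc t) = shiftX s 1 t - \<gamma> *\<^sub>R (\<Sum>l=1..n. shiftG s l t)"
  using assms btppX_Suc[of 1 s t] btppY_root[of s t] by (simp add: shiftX_def)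

text \<open>Root and child copy the same row in every round and so have equal iterates at equal
  times; only the shift by depth one remains.\<close>

lemma shiftX_child_of_root:
  assumes "j \<in> {2..n}" "parent B j = 1"
  shows "shiftX s j t = shiftX s 1 (t - 1)"
proof (cases "t \<le> 1")
  case True
  then show ?thesis using assms by (simp add: shiftX_def depth_parent[of j])
next
  case False
  then have t: "t - 1 = Suc (t - 2)" by simp
  have "shiftX s j t = btppX n B \<gamma> g x0 s (Suc (t - 2)) j"
    using assms t by (simp add: shiftX_def depth_parent[of j])
  also have "\<dots> = btppX n B \<gamma> g x0 s (Suc (t - 2)) 1"
    using assms btppX_Suc[of j s "t - 2"] btppX_Suc[of 1 s "t - 2"] by simp
  finally show ?thesis using t by (simp add: shiftX_def)
qed

text \<open>The lag two is made of one round for the passage from parent to child and one for the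
  difference of their depths.\<close>

lemma shiftX_nonroot:
  assumes j: "j \<in> {2..n}" and p: "parent B j \<noteq> 1"
  shows "shiftX s j t = shiftX s (parent B j) (t - 2) -
    \<gamma> *\<^sub>R (\<Sum>l\<in>subtree n B (parent B j). shiftG s l (t - 2) - shiftG s l (t - 2 - 1))"
proof -
  let ?p = "parent B j"
  have pin: "?p \<in> {2..n}" using parent_in[of j n B] j p parent_ge_1[of B j] by auto
  have dj: "depth B j = Suc (depth B ?p)" using j by (simp add: depth_parent)
  have dp: "0 < depth B ?p" using pin by (simp add: depth_pos)
  show ?thesis
  proof (cases "t \<le> depth B j")
    case True
    \<comment> \<open>Before \<open>j\<close> starts, no node below its parent has started at
      shifted time \<open>t - 2\<close>, so the recursion holds with both sides equal to
      \<open>x0\<close>.\<close>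
    have "shiftG s l u = 0" if "l \<in> subtree n B ?p" "u \<le> t - 2" for l u
    proof -
      have "depth B ?p \<le> depth B l"
        using that(1) depth_less_of_ancestor[of l B ?p] by (cases "l = ?p") (auto simp: subtree_def)
      then show ?thesis using True that(2) dj dp by (simp add: shiftG_def)
    qed
    then show ?thesis using True dj by (simp add: shiftX_early)
  next
    case False
    let ?u = "t - 2 - depth B ?p"
    have *: "t - depth B j = Suc ?u" "?u + depth B ?p = t - 2"
      using False dj dp by simp_all
    have "shiftX s j t = btppX n B \<gamma> g x0 s (Suc ?u) j" by (simp only: shiftX_def *)
    also have "\<dots> = btppX n B \<gamma> g x0 s ?u ?p - \<gamma> *\<^sub>R btppY n B \<gamma> g x0 s ?u ?p"
      using j by (intro btppX_Suc) auto
    also have "btppY n B \<gamma> g x0 s ?u ?p =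
        (\<Sum>l\<in>subtree n B ?p. shiftG s l (t - 2) - shiftG s l (t - 2 - 1))"
      by (simp only: btppY_nonroot[OF pin] *)
    finally show ?thesis by (simp add: shiftX_def)
  qed
qed

text \<open>A sample of node \<open>l\<close> drawn at time \<open>u\<close> is seen by the iterate of node \<open>i\<close> at time \<open>t\<close>
  only if \<open>u + depth B l < t + depth B i\<close>.\<close>

lemma btpp_cong:
  assumes "\<And>l u. l \<in> {1..n} \<Longrightarrow> u + depth B l < K \<Longrightarrow> s l u = s' l u" and "i \<in> {1..n}"
  shows "(t + depth B i \<le> K \<longrightarrow> btppX n B \<gamma> g x0 s t i = btppX n B \<gamma> g x0 s' t i) \<and>
         (t + depth B i < K \<longrightarrow> btppY n B \<gamma> g x0 s t i = btppY n B \<gamma> g x0 s' t i)"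
  using assms(2)
proof (induction t arbitrary: i)
  case 0
  then show ?case using assms(1) by auto
next
  case (Suc t)
  have dp: "depth B (parent B i) \<le> depth B i"
    using Suc.prems depth_parent[of i B] by (cases "i = 1") auto
  have X: "Suc t + depth B i \<le> K \<longrightarrow>
      btppX n B \<gamma> g x0 s (Suc t) i = btppX n B \<gamma> g x0 s' (Suc t) i"
    using Suc.IH[OF parent_in[OF Suc.prems]] dp by (simp add: btppX_Suc[OF Suc.prems])
  have ch: "c \<in> {1..n}" "depth B c = Suc (depth B i)" if "c \<in> children n B i" for c
    using that depth_parent[of c B] by (auto simp: children_def)
  have "btppY n B \<gamma> g x0 s (Suc t) i = btppY n B \<gamma> g x0 s' (Suc t) i" if K: "Suc t + depth B i < K"
  proof -
    have "(\<Sum>c\<in>children n B i. btppY n B \<gamma> g x0 s t c) = (\<Sum>c\<in>children n B i. btppY n B \<gamma> g x0 s' t c)"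
      using K ch Suc.IH by (intro sum.cong) auto
    moreover have "btppY n B \<gamma> g x0 s t i = btppY n B \<gamma> g x0 s' t i"
      "btppX n B \<gamma> g x0 s t i = btppX n B \<gamma> g x0 s' t i"
      using Suc.IH[OF Suc.prems] K by auto
    moreover have "btppX n B \<gamma> g x0 s (Suc t) i = btppX n B \<gamma> g x0 s' (Suc t) i"
      using X K by simp
    ultimately show ?thesis
      using assms(1)[OF Suc.prems, of t] assms(1)[OF Suc.prems, of "Suc t"] K
      by (auto simp: btppY_Suc[OF Suc.prems])
  qed
  with X show ?case by blast
qed

text \<open>The source space \<open>N\<close> is arbitrary because it will be the product space of
  past samples, in which the fresh sample is no coordinate. Hence measurability is demanded only of
  samples that can influence the value.\<close>

lemma btpp_measurable:
  assumes s: "\<And>l u. l \<in> {1..n} \<Longrightarrow> u + depth B l < K \<Longrightarrow> (\<lambda>\<omega>. s \<omega> l u) \<in> measurable N (D l)"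
    and g: "\<And>i. i \<in> {1..n} \<Longrightarrow> (\<lambda>(y, s). g i y s) \<in> borel_measurable (borel \<Otimes>\<^sub>M D i)"
    and "i \<in> {1..n}"
  shows "(t + depth B i \<le> K \<longrightarrow> (\<lambda>\<omega>. btppX n B \<gamma> g x0 (s \<omega>) t i) \<in> borel_measurable N) \<and>
         (t + depth B i < K \<longrightarrow> (\<lambda>\<omega>. btppY n B \<gamma> g x0 (s \<omega>) t i) \<in> borel_measurable N)"
  using assms(3)
proof (induction t arbitrary: i)
  case 0
  have "(\<lambda>\<omega>. g i x0 (s \<omega> i 0)) \<in> borel_measurable N" if "depth B i < K"
    using measurable_compose[OF measurable_Pair[OF measurable_const[of x0 borel] s] g[OF 0]] 0 that
    by simp
  then show ?case by auto
next
  case (Suc t)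
  have dp: "depth B (parent B i) \<le> depth B i"
    using Suc.prems depth_parent[of i B] by (cases "i = 1") auto
  have X: "Suc t + depth B i \<le> K \<longrightarrow>
      (\<lambda>\<omega>. btppX n B \<gamma> g x0 (s \<omega>) (Suc t) i) \<in> borel_measurable N"
    using Suc.IH[OF parent_in[OF Suc.prems, of B]] dp
    by (auto simp: btppX_Suc[OF Suc.prems] intro!: borel_measurable_diff borel_measurable_scaleR)
  have ch: "c \<in> {1..n}" "depth B c = Suc (depth B i)" if "c \<in> children n B i" for c
    using that depth_parent[of c B] by (auto simp: children_def)
  have "(\<lambda>\<omega>. btppY n B \<gamma> g x0 (s \<omega>) (Suc t) i) \<in> borel_measurable N" if K: "Suc t + depth B i < K"
  proof -
    have "(\<lambda>\<omega>. \<Sum>c\<in>children n B i. btppY n B \<gamma> g x0 (s \<omega>) t c) \<in> borel_measurable N"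
      using K ch Suc.IH by (intro borel_measurable_sum) auto
    moreover have "(\<lambda>\<omega>. if i = 1 then btppY n B \<gamma> g x0 (s \<omega>) t 1 else 0) \<in> borel_measurable N"
      using Suc.IH[OF Suc.prems] K by (cases "i = 1") auto
    moreover have "(\<lambda>\<omega>. g i (btppX n B \<gamma> g x0 (s \<omega>) t i) (s \<omega> i t)) \<in> borel_measurable N"
      using measurable_compose[OF measurable_Pair g[OF Suc.prems], of _ N] Suc.IH[OF Suc.prems]
        s[OF Suc.prems, of t] K by auto
    moreover have "(\<lambda>\<omega>. g i (btppX n B \<gamma> g x0 (s \<omega>) (Suc t) i) (s \<omega> i (Suc t))) \<in> borel_measurable N"
      using measurable_compose[OF measurable_Pair g[OF Suc.prems], of _ N] X
        s[OF Suc.prems, of "Suc t"] K by (auto)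
    ultimately show ?thesis
      unfolding btppY_Suc[OF Suc.prems] by (intro borel_measurable_add borel_measurable_diff)
  qed
  with X show ?case by blast
qed

end

section \<open>Smooth functions\<close>

lemma smooth_upper_bound:
  fixes f :: "'a::euclidean_space \<Rightarrow> real"
  assumes diff: "\<And>y. f differentiable (at y)" and lip: "L-lipschitz_on UNIV (gradient f)"
  shows "f y \<le> f x + gradient f x \<bullet> (y - x) + L / 2 * (norm (y - x))\<^sup>2"
proof -
  define h where "h = y - x"
  define \<phi> where "\<phi> t = f (x + t *\<^sub>R h) - t * (gradient f x \<bullet> h) - L / 2 * t\<^sup>2 * (norm h)\<^sup>2" for t
  have "\<exists>D. DERIV \<phi> t :> D \<and> D \<le> 0" if t: "0 \<le> t" for t
  proof -
    let ?D = "h \<bullet> gradient f (x + t *\<^sub>R h) - gradient f x \<bullet> h - L * t * (norm h)\<^sup>2"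
    have "(f has_derivative (\<lambda>k. k \<bullet> gradient f (x + t *\<^sub>R h))) (at (x + t *\<^sub>R h))"
      using GDERIV_gradient[OF diff] by (simp add: gderiv_def)
    moreover have "((\<lambda>t. x + t *\<^sub>R h) has_derivative (\<lambda>k. k *\<^sub>R h)) (at t)"
      by (auto intro!: derivative_eq_intros)
    ultimately have "((\<lambda>t. f (x + t *\<^sub>R h)) has_derivative
        (\<lambda>k. (k *\<^sub>R h) \<bullet> gradient f (x + t *\<^sub>R h))) (at t)"
      by (rule has_derivative_compose[rotated])
    then have "((\<lambda>t. f (x + t *\<^sub>R h)) has_real_derivative h \<bullet> gradient f (x + t *\<^sub>R h)) (at t)"
      unfolding has_field_derivative_def by (rule has_derivative_eq_rhs) (simp add: fun_eq_iff)
    then have "DERIV \<phi> t :> ?D"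
      unfolding \<phi>_def by (auto intro!: derivative_eq_intros)
    moreover have "?D \<le> 0"
    proof -
      have "h \<bullet> gradient f (x + t *\<^sub>R h) - gradient f x \<bullet> h =
          h \<bullet> (gradient f (x + t *\<^sub>R h) - gradient f x)"
        by (simp add: inner_diff_right inner_commute)
      also have "\<dots> \<le> norm h * norm (gradient f (x + t *\<^sub>R h) - gradient f x)"
        by (rule norm_cauchy_schwarz)
      also have "\<dots> \<le> norm h * (L * (t * norm h))"
        using lipschitz_onD[OF lip, of "x + t *\<^sub>R h" x] t
        by (intro mult_left_mono) (auto simp: dist_norm)
      finally show ?thesis by (simp add: power2_eq_square algebra_simps)
    qed
    ultimately show ?thesis by blast
  qed
  then have "\<phi> 1 \<le> \<phi> 0"
    by (rule DERIV_nonpos_imp_nonincreasing[OF zero_le_one])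
  then show ?thesis by (simp add: \<phi>_def h_def)
qed

text \<open>A gradient step of length \<open>1 / L\<close> lowers \<open>f\<close> by at least the
  squared gradient norm over \<open>2 * L\<close>, and it cannot fall below
  \<open>c\<close>.\<close>

lemma norm_gradient_le_suboptimality:
  fixes f :: "'a::euclidean_space \<Rightarrow> real"
  assumes "\<And>y. f differentiable (at y)" and "L-lipschitz_on UNIV (gradient f)"
    and L: "L > 0" and low: "\<And>y. c \<le> f y"
  shows "(norm (gradient f x))\<^sup>2 \<le> 2 * L * (f x - c)"
proof -
  let ?g = "gradient f x"
  have "c \<le> f (x - (1 / L) *\<^sub>R ?g)" by (rule low)
  also have "\<dots> \<le> f x - (1 / L) * (norm ?g)\<^sup>2 + L / 2 * (norm ((1 / L) *\<^sub>R ?g))\<^sup>2"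
    using smooth_upper_bound[OF assms(1,2), of "x - (1 / L) *\<^sub>R ?g" x]
    by (simp add: dot_square_norm)
  also have "L / 2 * (norm ((1 / L) *\<^sub>R ?g))\<^sup>2 = (1 / (2 * L)) * (norm ?g)\<^sup>2"
    using L by (simp add: power_mult_distrib power_divide power2_eq_square)
  finally have "(1 / (2 * L)) * (norm ?g)\<^sup>2 \<le> f x - c"
    using L by (simp add: field_simps)
  then show ?thesis using L by (simp add: field_simps)
qed

lemma GDERIV_avg_objective:
  fixes f :: "nat \<Rightarrow> 'a::euclidean_space \<Rightarrow> real"
  assumes "\<And>i. i \<in> {1..n} \<Longrightarrow> f i differentiable (at y)"
  shows "GDERIV (avg_objective n f) y :> (1 / real n) *\<^sub>R (\<Sum>i=1..n. gradient (f i) y)"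
proof -
  have "((\<lambda>y. 1 / real n * (\<Sum>i=1..n. f i y)) has_derivative
      (\<lambda>h. 1 / real n * (\<Sum>i=1..n. h \<bullet> gradient (f i) y))) (at y)"
    using GDERIV_gradient[OF assms] unfolding gderiv_def
    by (intro has_derivative_mult_right has_derivative_sum)
  then show ?thesis
    by (simp add: gderiv_def avg_objective_def[abs_def] inner_sum_right)
qed

lemma gradient_avg_objective:
  fixes f :: "nat \<Rightarrow> 'a::euclidean_space \<Rightarrow> real"
  assumes "\<And>i. i \<in> {1..n} \<Longrightarrow> f i differentiable (at y)"
  shows "gradient (avg_objective n f) y = (1 / real n) *\<^sub>R (\<Sum>i=1..n. gradient (f i) y)"
  using GDERIV_avg_objective[OF assms] by (rule gradient_eqI)

lemma lipschitz_gradient_avg_objective: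
  fixes f :: "nat \<Rightarrow> 'a::euclidean_space \<Rightarrow> real"
  assumes "\<And>i y. i \<in> {1..n} \<Longrightarrow> f i differentiable (at y)" and "n \<ge> 1"
    and lip: "\<And>i. i \<in> {1..n} \<Longrightarrow> L-lipschitz_on UNIV (gradient (f i))"
  shows "L-lipschitz_on UNIV (gradient (avg_objective n f))"
proof (rule lipschitz_onI)
  fix x y
  have "gradient (avg_objective n f) z = (1 / real n) *\<^sub>R (\<Sum>i=1..n. gradient (f i) z)" for z
    by (rule gradient_avg_objective) (rule assms(1))
  then have "dist (gradient (avg_objective n f) x) (gradient (avg_objective n f) y) =
      1 / real n * norm (\<Sum>i=1..n. gradient (f i) x - gradient (f i) y)"
    by (simp add: dist_norm sum_subtractf flip: scaleR_diff_right)
  also have "\<dots> \<le> 1 / real n * (\<Sum>i=1..n. L * dist x y)"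
    using lipschitz_onD[OF lip] by (intro mult_left_mono sum_norm_le) (auto simp: dist_norm)
  finally show "dist (gradient (avg_objective n f) x) (gradient (avg_objective n f) y) \<le> L * dist x y"
    using assms(2) by simp
next
  show "0 \<le> L" using lip[of 1] assms(2) lipschitz_on_nonneg by auto
qed

section \<open>Pathwise estimates\<close>

lemma norm_sum_sq_le:
  fixes v :: "'b \<Rightarrow> 'a::real_inner"
  assumes "finite A" "real (card A) \<le> c"
  shows "(norm (\<Sum>i\<in>A. v i))\<^sup>2 \<le> c * (\<Sum>i\<in>A. (norm (v i))\<^sup>2)"
proof -
  have "(norm (\<Sum>i\<in>A. v i))\<^sup>2 \<le> (\<Sum>i\<in>A. norm (v i) * 1)\<^sup>2"
    by (intro power_mono) (simp_all add: norm_sum)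
  also have "\<dots> \<le> (\<Sum>i\<in>A. (norm (v i))\<^sup>2) * (\<Sum>i\<in>A. 1\<^sup>2)"
    by (rule Cauchy_Schwarz_ineq_sum)
  also have "\<dots> \<le> c * (\<Sum>i\<in>A. (norm (v i))\<^sup>2)"
    using assms by (simp add: mult.commute mult_right_mono sum_nonneg)
  finally show ?thesis .
qed

text \<open>Young's inequality; the weight is left free because \<open>k\<close> will be the depth
  of a node.\<close>

lemma norm_add_sq_weighted:
  fixes a b :: "'a::real_inner"
  assumes "k > 0"
  shows "(norm (a + b))\<^sup>2 \<le> (1 + 1 / k) * (norm a)\<^sup>2 + (1 + k) * (norm b)\<^sup>2"
proof -
  have "0 \<le> (norm ((1 / sqrt k) *\<^sub>R a - sqrt k *\<^sub>R b))\<^sup>2" by simp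
  also have "\<dots> = (1 / k) * (norm a)\<^sup>2 + k * (norm b)\<^sup>2 - 2 * (a \<bullet> b)"
    using assms unfolding power2_norm_eq_inner
    by (simp add: inner_diff_left inner_diff_right inner_commute field_simps)
  finally show ?thesis
    unfolding power2_norm_eq_inner
    by (simp add: inner_add_left inner_add_right inner_commute algebra_simps)
qed

lemma norm_add_sq_le: "(norm (a + b))\<^sup>2 \<le> 2 * (norm a)\<^sup>2 + 2 * (norm (b::'a::real_inner))\<^sup>2"
  using norm_add_sq_weighted[of 1 a b] by simp

lemma norm_diff_sq_le: "(norm (a - b))\<^sup>2 \<le> 2 * (norm a)\<^sup>2 + 2 * (norm (b::'a::real_inner))\<^sup>2"
  using norm_add_sq_le[of a "- b"] by simp

lemma norm_add3_sq_le:
  fixes a b c :: "'a::real_inner"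
  shows "(norm (a + b + c))\<^sup>2 \<le> 3 * (norm a)\<^sup>2 + 3 * (norm b)\<^sup>2 + 3 * (norm c)\<^sup>2"
  using norm_add_sq_weighted[of 2 "a + b" c] norm_add_sq_le[of a b] by (simp add: algebra_simps)

lemma inner_le_weighted:
  fixes a b :: "'a::real_inner"
  assumes "k > 0"
  shows "a \<bullet> b \<le> k * (norm a)\<^sup>2 + (norm b)\<^sup>2 / (4 * k)"
proof -
  have "0 \<le> (norm ((2 * k) *\<^sub>R a - b))\<^sup>2 / (4 * k)" using assms by simp
  also have "(norm ((2 * k) *\<^sub>R a - b))\<^sup>2 = 4 * k * (k * (norm a)\<^sup>2 - a \<bullet> b) + (norm b)\<^sup>2"
    unfolding power2_norm_eq_inner
    by (simp add: inner_diff_left inner_diff_right inner_commute algebra_simps)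
  finally show ?thesis using assms by (simp add: add_divide_distrib)
qed

text \<open>Truncated subtraction repeats \<open>\<phi> 0\<close> at the start. As this value is
  zero, a delay merely drops final terms.\<close>

lemma sum_shift_le:
  fixes \<phi> :: "nat \<Rightarrow> real"
  assumes "\<And>t. 0 \<le> \<phi> t" "\<phi> 0 = 0"
  shows "(\<Sum>t\<le>T. \<phi> (t - k)) \<le> (\<Sum>t\<le>T. \<phi> t)"
proof (induction k)
  case (Suc k)
  have "(\<Sum>t\<le>T. \<phi> (t - Suc k)) = (\<Sum>t<T. \<phi> (t - k))"
    using assms(2) by (simp add: sum.atMost_shift)
  also have "\<dots> \<le> (\<Sum>t\<le>T. \<phi> (t - k))"
    using assms(1) by (intro sum_mono2) auto
  finally show ?case using Suc by simp
qed simp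

lemma card_ancestor_le: "i \<in> {1..n} \<Longrightarrow> card {q \<in> {1..n}. ancestor B q i} \<le> Suc (depth B i)"
proof (induction i rule: less_induct)
  case (less i)
  show ?case
  proof (cases "i = 1")
    case False
    then have i: "1 < i" using less.prems by auto
    have "{q \<in> {1..n}. ancestor B q i} \<subseteq> insert i {q \<in> {1..n}. ancestor B q (parent B i)}"
      by (auto simp: ancestor_iff[of B _ i])
    then have "card {q \<in> {1..n}. ancestor B q i} \<le> card (insert i {q \<in> {1..n}. ancestor B q (parent B i)})"
      by (intro card_mono) auto
    also have "\<dots> \<le> Suc (card {q \<in> {1..n}. ancestor B q (parent B i)})"
      by (simp add: card_insert_if)
    finally have "card {q \<in> {1..n}. ancestor B q i} \<le> Suc (card {q \<in> {1..n}. ancestor B q (parent B i)})" .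
    then show ?thesis
      using less.IH[of "parent B i"] parent_less[OF i, of B] parent_in[OF less.prems, of B] depth_parent[OF i, of B]
      by simp
  next
    case True
    have "{q \<in> {1..n}. q = Suc 0} \<subseteq> {Suc 0}" by auto
    then have "card {q \<in> {1..n}. q = Suc 0} \<le> card {Suc 0}" by (intro card_mono) auto
    then show ?thesis using True by simp
  qed
qed

text \<open>A single sample path as a deterministic system: \<open>e\<close> is an arbitrary
  perturbation that vanishes before an agent starts, and nothing derived here relies on its
  law.\<close>

locale delayed_descent =
  fixes n d B T :: nat and L \<gamma> \<Delta> :: real
    and F :: "'a::euclidean_space \<Rightarrow> real" and G :: "nat \<Rightarrow> 'a \<Rightarrow> 'a" and gF :: "'a \<Rightarrow> 'a"
    and x0 :: 'a and Z e :: "nat \<Rightarrow> nat \<Rightarrow> 'a"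
  assumes n: "n \<ge> 1" and d: "d \<ge> 1" and L: "L > 0" and \<gamma>: "\<gamma> > 0"
    and depth_le: "\<And>i. i \<in> {1..n} \<Longrightarrow> depth B i \<le> d"
    and step: "100 * real n * real d ^ 3 * L * \<gamma> \<le> 1"
    and lip: "\<And>i y z. i \<in> {1..n} \<Longrightarrow> norm (G i y - G i z) \<le> L * norm (y - z)"
    and gF: "\<And>y. real n *\<^sub>R gF y = (\<Sum>i=1..n. G i y)"
    and smooth: "\<And>y z. F z \<le> F y + gF y \<bullet> (z - y) + L / 2 * (norm (z - y))\<^sup>2"
    and gF_lip: "\<And>y z. norm (gF y - gF z) \<le> L * norm (y - z)"
    and low: "\<And>y. F x0 - \<Delta> \<le> F y"
    and grad0: "(norm (gF x0))\<^sup>2 \<le> 2 * L * \<Delta>"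
    and e_early: "\<And>j t. t < depth B j \<Longrightarrow> e j t = 0"
    and Z_early: "\<And>j t. t \<le> depth B j \<Longrightarrow> Z j t = x0"
    and Z_root: "\<And>t. Z 1 (Suc t) = Z 1 t -
        \<gamma> *\<^sub>R (\<Sum>j=1..n. (if depth B j \<le> t then G j (Z j t) else 0) + e j t)"
    and Z_child: "\<And>j t. j \<in> {2..n} \<Longrightarrow> parent B j = 1 \<Longrightarrow> Z j t = Z 1 (t - 1)"
    and Z_nonroot: "\<And>j t. j \<in> {2..n} \<Longrightarrow> parent B j \<noteq> 1 \<Longrightarrow> Z j t = Z (parent B j) (t - 2) -
        \<gamma> *\<^sub>R (\<Sum>l\<in>subtree n B (parent B j).
          ((if depth B l \<le> t - 2 then G l (Z l (t - 2)) else 0) + e l (t - 2)) -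
          ((if depth B l \<le> t - 2 - 1 then G l (Z l (t - 2 - 1)) else 0) + e l (t - 2 - 1)))"
begin

section \<open>Time-summed error quantities\<close>

definition Gh where "Gh j t = (if depth B j \<le> t then G j (Z j t) else 0)"
definition r where "r t = Z 1 t"
definition u where "u t = (\<Sum>j=1..n. Gh j t)"
definition N where "N q t = (\<Sum>l\<in>subtree n B q. e l t)"
definition w where "w q t = (\<Sum>l\<in>subtree n B q. (Gh l t + e l t) - (Gh l (t - 1) + e l (t - 1)))"
text \<open>The gradients still missing in \<open>u\<close>, taken at \<open>x0\<close> because
  agents that have not started sit there.\<close>

definition m where "m t = (\<Sum>j=1..n. if depth B j \<le> t then 0 else G j x0)"
definition q where "q t = (\<Sum>j=1..n. G j (r t) - G j (Z j t))"

definition S where "S = (\<Sum>t\<le>T. (norm (gF (r t)))\<^sup>2)"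
definition U where "U = (\<Sum>t\<le>T. (norm (u t))\<^sup>2)"
definition \<rho> where "\<rho> = (\<Sum>t\<le>T. (norm (r t - r (t - 1)))\<^sup>2)"
definition Psi where "Psi j = (\<Sum>t\<le>T. (norm (Z j t - r t))\<^sup>2)"
definition Phi where "Phi = (\<Sum>j=1..n. Psi j)"
definition Bq where "Bq p = (\<Sum>t\<le>T. (norm (N p t))\<^sup>2)"
definition F0 where "F0 = (\<Sum>i=1..n. (norm (G i x0))\<^sup>2)"
definition NP where "NP = (\<Sum>j\<in>{2..n}. \<Sum>p | p \<in> {1..n} \<and> ancestor B p (parent B j). Bq p)"
definition \<kappa> where "\<kappa> = (\<gamma> * real n * L * real d)\<^sup>2"
text \<open>Bounds the noise-free part of the trackers. It contains \<open>Psi\<close>, which makes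
  the later estimate of \<open>Phi\<close> refer to itself.\<close>

definition WG where "WG = real n * (\<Sum>l=1..n. L\<^sup>2 * (6 * Psi l + 3 * \<rho>) + (norm (G l x0))\<^sup>2)"
definition Kc where "Kc = 8 * \<rho> + 4 * \<gamma>\<^sup>2 * WG"
text \<open>Bounds the time-summed squared displacement that is added on an edge below
  \<open>p\<close>.\<close>

definition K where "K p = Kc + 16 * \<gamma>\<^sup>2 * Bq p"

lemma nonneg: "0 \<le> S" "0 \<le> U" "0 \<le> \<rho>" "0 \<le> Psi j" "0 \<le> Phi" "0 \<le> Bq p" "0 \<le> F0" "0 \<le> NP"
  "0 \<le> \<kappa>" "0 \<le> WG" "0 \<le> Kc" "0 \<le> K p"
proof -
  show 1: "0 \<le> S" "0 \<le> U" "0 \<le> \<rho>" "0 \<le> F0" "0 \<le> \<kappa>"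
    by (simp_all add: S_def U_def \<rho>_def F0_def \<kappa>_def sum_nonneg)
  show 2: "0 \<le> Psi j" "0 \<le> Bq p" for j p
    by (simp_all add: Psi_def Bq_def sum_nonneg)
  show 3: "0 \<le> Phi" "0 \<le> NP" "0 \<le> WG"
    using 1 2 by (simp_all add: Phi_def NP_def WG_def sum_nonneg)
  show "0 \<le> Kc" "0 \<le> K p"
    using 1 2 3 by (simp_all add: Kc_def K_def)
qed

lemma r_0: "r 0 = x0"
  using Z_early[of 0 1] by (simp add: r_def)

lemma r_Suc: "r (Suc t) = r t - \<gamma> *\<^sub>R (u t + N 1 t)"
  by (simp add: r_def Z_root[simplified] u_def N_def Gh_def subtree_root sum.distrib)

lemma Z_root_eq: "Z 1 t = r t"
  by (simp add: r_def)

lemma rho_le: "\<rho> \<le> 2 * \<gamma>\<^sup>2 * (U + Bq 1)"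
proof -
  have "\<rho> = (\<Sum>t<T. (norm (r (Suc t) - r t))\<^sup>2)"
    by (simp add: \<rho>_def sum.atMost_shift)
  also have "\<dots> \<le> (\<Sum>t\<le>T. (norm (r (Suc t) - r t))\<^sup>2)"
    by (intro sum_mono2) auto
  also have "\<dots> \<le> (\<Sum>t\<le>T. \<gamma>\<^sup>2 * (2 * (norm (u t))\<^sup>2 + 2 * (norm (N 1 t))\<^sup>2))"
  proof (intro sum_mono)
    fix t
    have "(norm (r (Suc t) - r t))\<^sup>2 = \<gamma>\<^sup>2 * (norm (u t + N 1 t))\<^sup>2"
      by (simp add: r_Suc power_mult_distrib)
    then show "(norm (r (Suc t) - r t))\<^sup>2 \<le> \<gamma>\<^sup>2 * (2 * (norm (u t))\<^sup>2 + 2 * (norm (N 1 t))\<^sup>2)"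
      using norm_add_sq_le[of "u t" "N 1 t"] by (simp add: mult_left_mono)
  qed
  also have "\<dots> = 2 * \<gamma>\<^sup>2 * (U + Bq 1)"
    by (simp add: U_def Bq_def sum.distrib sum_distrib_left algebra_simps)
  finally show ?thesis .
qed

text \<open>After the start, \<open>Z l\<close> moves by at most its deviations from the root at
  both times plus the root increment. The last term is the one jump from zero when agent
  \<open>l\<close> starts.\<close>

lemma sum_Gh_diff_le:
  assumes l: "l \<in> {1..n}"
  shows "(\<Sum>t\<le>T. (norm (Gh l t - Gh l (t - 1)))\<^sup>2) \<le> L\<^sup>2 * (6 * Psi l + 3 * \<rho>) + (norm (G l x0))\<^sup>2"
proof -
  let ?\<phi> = "\<lambda>t. (norm (Z l t - r t))\<^sup>2" and ?D = "\<lambda>t. (norm (r t - r (t - 1)))\<^sup>2"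
  have "(norm (Gh l t - Gh l (t - 1)))\<^sup>2 \<le>
      L\<^sup>2 * (3 * ?\<phi> t + 3 * ?\<phi> (t - 1) + 3 * ?D t) + (if t = depth B l then (norm (G l x0))\<^sup>2 else 0)" for t
  proof (cases "t \<le> depth B l")
    case True
    then show ?thesis by (auto simp: Gh_def Z_early)
  next
    case False
    have "norm (Gh l t - Gh l (t - 1)) \<le> L * norm (Z l t - Z l (t - 1))"
      using False lip[OF l, of "Z l t" "Z l (t - 1)"] by (auto simp: Gh_def)
    then have "(norm (Gh l t - Gh l (t - 1)))\<^sup>2 \<le> L\<^sup>2 * (norm (Z l t - Z l (t - 1)))\<^sup>2"
      by (metis norm_ge_zero power_mono power_mult_distrib)
    also have "(norm (Z l t - Z l (t - 1)))\<^sup>2 \<le> 3 * ?\<phi> t + 3 * ?\<phi> (t - 1) + 3 * ?D t"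
      using norm_add3_sq_le[of "Z l t - r t" "r (t - 1) - Z l (t - 1)" "r t - r (t - 1)"]
      by (simp add: norm_minus_commute[of "r (t - Suc 0)" "Z l (t - Suc 0)"] algebra_simps)
    finally show ?thesis using False by (simp add: mult_left_mono)
  qed
  then have "(\<Sum>t\<le>T. (norm (Gh l t - Gh l (t - 1)))\<^sup>2) \<le>
      (\<Sum>t\<le>T. L\<^sup>2 * (3 * ?\<phi> t + 3 * ?\<phi> (t - 1) + 3 * ?D t) + (if t = depth B l then (norm (G l x0))\<^sup>2 else 0))"
    by (rule sum_mono)
  also have "\<dots> = L\<^sup>2 * (3 * Psi l + 3 * (\<Sum>t\<le>T. ?\<phi> (t - 1)) + 3 * \<rho>) +
      (if depth B l \<le> T then (norm (G l x0))\<^sup>2 else 0)"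
    by (simp add: Psi_def \<rho>_def sum.distrib sum_distrib_left algebra_simps)
  also have "(\<Sum>t\<le>T. ?\<phi> (t - 1)) \<le> Psi l"
    unfolding Psi_def by (rule sum_shift_le) (simp_all add: Z_early r_0)
  finally show ?thesis by (auto simp: mult_left_mono intro: add_increasing2 split: if_splits)
qed

lemma sum_w_le:
  assumes p: "p \<in> {2..n}"
  shows "(\<Sum>t\<le>T. (norm (w p t))\<^sup>2) \<le> 2 * WG + 8 * Bq p"
proof -
  let ?w = "\<lambda>t. \<Sum>l\<in>subtree n B p. Gh l t - Gh l (t - 1)"
  have card: "real (card (subtree n B p)) \<le> real n"
    using card_mono[OF _ subtree_subset[of n B p]] by simp
  have "(\<Sum>t\<le>T. (norm (?w t))\<^sup>2) \<le> (\<Sum>t\<le>T. real n * (\<Sum>l\<in>subtree n B p. (norm (Gh l t - Gh l (t - 1)))\<^sup>2))"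
    using card by (intro sum_mono norm_sum_sq_le) auto
  also have "\<dots> \<le> (\<Sum>t\<le>T. real n * (\<Sum>l=1..n. (norm (Gh l t - Gh l (t - 1)))\<^sup>2))"
    using subtree_subset[of n B p] by (intro sum_mono mult_left_mono sum_mono2) auto
  also have "\<dots> = real n * (\<Sum>l=1..n. \<Sum>t\<le>T. (norm (Gh l t - Gh l (t - 1)))\<^sup>2)"
    by (subst sum.swap) (simp add: sum_distrib_left)
  also have "\<dots> \<le> WG"
    unfolding WG_def by (intro mult_left_mono sum_mono sum_Gh_diff_le) auto
  finally have G: "(\<Sum>t\<le>T. (norm (?w t))\<^sup>2) \<le> WG" .
  \<comment> \<open>Required for the delayed sum below: only the root can have noise at shifted time
    zero, and it is not in the subtree of \<open>p\<close>.\<close>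
  have N0: "N p 0 = 0"
    unfolding N_def
  proof (rule sum.neutral, safe)
    fix l assume l: "l \<in> subtree n B p"
    then have "l \<noteq> 1" using ancestor_le[of l B p] p by (auto simp: subtree_def)
    then show "e l 0 = 0" using l by (intro e_early depth_pos) (auto simp: subtree_def)
  qed
  have "(norm (w p t))\<^sup>2 \<le> 2 * (norm (?w t))\<^sup>2 + 4 * (norm (N p t))\<^sup>2 + 4 * (norm (N p (t - 1)))\<^sup>2" for t
  proof -
    have "w p t = ?w t + (N p t - N p (t - 1))"
      by (simp add: w_def N_def sum.distrib sum_subtractf)
    then show ?thesis
      using norm_add_sq_le[of "?w t" "N p t - N p (t - 1)"] norm_diff_sq_le[of "N p t" "N p (t - 1)"]
      by simp
  qed
  then have "(\<Sum>t\<le>T. (norm (w p t))\<^sup>2) \<le>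
      (\<Sum>t\<le>T. 2 * (norm (?w t))\<^sup>2 + 4 * (norm (N p t))\<^sup>2 + 4 * (norm (N p (t - 1)))\<^sup>2)"
    by (rule sum_mono)
  also have "\<dots> = 2 * (\<Sum>t\<le>T. (norm (?w t))\<^sup>2) + 4 * Bq p + 4 * (\<Sum>t\<le>T. (norm (N p (t - 1)))\<^sup>2)"
    by (simp add: Bq_def sum.distrib sum_distrib_left)
  also have "(\<Sum>t\<le>T. (norm (N p (t - 1)))\<^sup>2) \<le> Bq p"
    unfolding Bq_def by (rule sum_shift_le) (simp_all add: N0)
  finally show ?thesis using G by simp
qed

lemma sum_back_two_le: "(\<Sum>t\<le>T. (norm (r (t - 2) - r t))\<^sup>2) \<le> 4 * \<rho>"
proof -
  let ?D = "\<lambda>t. (norm (r t - r (t - 1)))\<^sup>2"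
  have "(norm (r (t - 2) - r t))\<^sup>2 \<le> 2 * ?D (t - 1) + 2 * ?D t" for t
  proof -
    have "r t - r (t - 2) = (r (t - 1) - r (t - 1 - 1)) + (r t - r (t - 1))"
      by (simp add: numeral_2_eq_2)
    then show ?thesis
      using norm_add_sq_le[of "r (t - 1) - r (t - 1 - 1)" "r t - r (t - 1)"]
      by (simp only: norm_minus_commute[of "r (t - 2)" "r t"])
  qed
  then have "(\<Sum>t\<le>T. (norm (r (t - 2) - r t))\<^sup>2) \<le> (\<Sum>t\<le>T. 2 * ?D (t - 1) + 2 * ?D t)"
    by (rule sum_mono)
  also have "\<dots> = 2 * (\<Sum>t\<le>T. ?D (t - 1)) + 2 * \<rho>"
    by (simp add: \<rho>_def sum.distrib sum_distrib_left)
  also have "(\<Sum>t\<le>T. ?D (t - 1)) \<le> \<rho>"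
    unfolding \<rho>_def by (rule sum_shift_le) simp_all
  finally show ?thesis by simp
qed

text \<open>Down one edge the deviation gains the root movement over two rounds and the tracker step
  of the parent. The weight is tuned to the induction that follows.\<close>

lemma Psi_step:
  assumes j: "j \<in> {2..n}" and p: "parent B j \<noteq> 1" and k: "k = real (depth B (parent B j))"
  shows "Psi j \<le> (1 + 1 / k) * Psi (parent B j) + (1 + k) * K (parent B j)"
proof -
  let ?p = "parent B j"
  have pin: "?p \<in> {2..n}" using parent_in[of j n B] j p parent_ge_1[of B j] by auto
  then have k0: "k > 0" by (simp add: k depth_pos)
  let ?v = "\<lambda>t. (r (t - 2) - r t) - \<gamma> *\<^sub>R w ?p (t - 2)"
  have "(norm (Z j t - r t))\<^sup>2 \<le>
      (1 + 1 / k) * (norm (Z ?p (t - 2) - r (t - 2)))\<^sup>2 + (1 + k) * (norm (?v t))\<^sup>2" for t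
  proof -
    have "Z j t - r t = (Z ?p (t - 2) - r (t - 2)) + ?v t"
      unfolding Z_nonroot[OF j p] w_def Gh_def by simp
    then show ?thesis
      using norm_add_sq_weighted[OF k0, of "Z ?p (t - 2) - r (t - 2)" "?v t"] by (simp only:)
  qed
  then have "Psi j \<le> (\<Sum>t\<le>T. (1 + 1 / k) * (norm (Z ?p (t - 2) - r (t - 2)))\<^sup>2 +
      (1 + k) * (norm (?v t))\<^sup>2)"
    unfolding Psi_def by (rule sum_mono)
  also have "\<dots> = (1 + 1 / k) * (\<Sum>t\<le>T. (norm (Z ?p (t - 2) - r (t - 2)))\<^sup>2) +
      (1 + k) * (\<Sum>t\<le>T. (norm (?v t))\<^sup>2)"
    by (simp only: sum.distrib sum_distrib_left)
  also have "\<dots> \<le> (1 + 1 / k) * Psi ?p + (1 + k) * K ?p"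
  proof (intro add_mono mult_left_mono)
    show "(\<Sum>t\<le>T. (norm (Z ?p (t - 2) - r (t - 2)))\<^sup>2) \<le> Psi ?p"
      unfolding Psi_def by (rule sum_shift_le) (simp_all add: Z_early r_0)
    have "(\<Sum>t\<le>T. (norm (?v t))\<^sup>2) \<le>
        (\<Sum>t\<le>T. 2 * (norm (r (t - 2) - r t))\<^sup>2 + 2 * \<gamma>\<^sup>2 * (norm (w ?p (t - 2)))\<^sup>2)"
      by (intro sum_mono order_trans[OF norm_diff_sq_le]) (simp add: power_mult_distrib)
    also have "\<dots> = 2 * (\<Sum>t\<le>T. (norm (r (t - 2) - r t))\<^sup>2) +
        2 * \<gamma>\<^sup>2 * (\<Sum>t\<le>T. (norm (w ?p (t - 2)))\<^sup>2)"
      by (simp only: sum.distrib sum_distrib_left)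
    also have "\<dots> \<le> 2 * (4 * \<rho>) + 2 * \<gamma>\<^sup>2 * (2 * WG + 8 * Bq ?p)"
    proof (intro add_mono mult_left_mono sum_back_two_le)
      have "(\<Sum>t\<le>T. (norm (w ?p (t - 2)))\<^sup>2) \<le> (\<Sum>t\<le>T. (norm (w ?p t))\<^sup>2)"
        by (rule sum_shift_le) (simp_all add: w_def)
      also have "\<dots> \<le> 2 * WG + 8 * Bq ?p" by (rule sum_w_le[OF pin])
      finally show "(\<Sum>t\<le>T. (norm (w ?p (t - 2)))\<^sup>2) \<le> 2 * WG + 8 * Bq ?p" .
    qed simp_all
    also have "\<dots> = K ?p" by (simp add: K_def Kc_def algebra_simps)
    finally show "(\<Sum>t\<le>T. (norm (?v t))\<^sup>2) \<le> K ?p" .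
  qed (use k0 in simp_all)
  finally show ?thesis .
qed

text \<open>Induction from the children of the root, whose deviation is a single root increment and
  hence below \<open>K 1\<close>.\<close>

lemma Psi_le:
  assumes "j \<in> {2..n}"
  shows "Psi j \<le> real (depth B j) * (\<Sum>p | p \<in> {1..n} \<and> ancestor B p (parent B j). K p)"
  using assms
proof (induction j rule: less_induct)
  case (less j)
  let ?p = "parent B j"
  have j: "j \<in> {1..n}" "1 < j" using less.prems by auto
  have dj: "depth B j = Suc (depth B ?p)" using j by (simp add: depth_parent)
  show ?case
  proof (cases "?p = 1")
    case True
    have "Psi j = (\<Sum>t\<le>T. (norm (r (t - 1) - r t))\<^sup>2)"
      using Z_child[OF less.prems True] by (simp add: Psi_def Z_root_eq[simplified])
    also have "\<dots> = \<rho>" by (simp add: \<rho>_def norm_minus_commute)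
    also have "\<dots> \<le> K 1"
      using nonneg(3,10) nonneg(6)[of 1] by (simp add: K_def Kc_def)
    also have "{p. p \<in> {1..n} \<and> ancestor B p ?p} = {1}"
      using n True by auto
    then have "K 1 = real (depth B j) * (\<Sum>p | p \<in> {1..n} \<and> ancestor B p (parent B j). K p)"
      using True dj by simp
    finally show ?thesis .
  next
    case False
    define k where "k = real (depth B ?p)"
    let ?\<Lambda> = "\<Sum>p | p \<in> {1..n} \<and> ancestor B p (parent B ?p). K p"
    have pin: "?p \<in> {2..n}" using parent_in[OF j(1), of B] False parent_ge_1[of B j] by auto
    then have k0: "k > 0" by (simp add: k_def depth_pos)
    have "{p. p \<in> {1..n} \<and> ancestor B p ?p} = insert ?p {p. p \<in> {1..n} \<and> ancestor B p (parent B ?p)}"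
      using pin by (auto simp: ancestor_iff[of B _ ?p])
    moreover have "\<not> ancestor B ?p (parent B ?p)"
      using ancestor_le[of "parent B ?p" B ?p] parent_less[of ?p B] parent_ge_1[of B ?p] pin by auto
    ultimately have \<Lambda>: "(\<Sum>p | p \<in> {1..n} \<and> ancestor B p ?p. K p) = K ?p + ?\<Lambda>"
      by simp
    have "Psi j \<le> (1 + 1 / k) * Psi ?p + (1 + k) * K ?p"
      using Psi_step[OF less.prems False k_def] .
    also have "\<dots> \<le> (1 + 1 / k) * (k * ?\<Lambda>) + (1 + k) * K ?p"
      using less.IH[OF parent_less pin] j k0 by (intro add_mono mult_left_mono) (auto simp: k_def)
    \<comment> \<open>The weights telescope: the factor \<open>k\<close> for the path above becomes
      \<open>1 + k\<close>, which is also the factor of the new edge.\<close>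
    also have "(1 + 1 / k) * (k * ?\<Lambda>) = (1 + k) * ?\<Lambda>"
      using k0 by (simp add: field_simps)
    finally show ?thesis
      unfolding \<Lambda> by (simp add: dj k_def algebra_simps)
  qed
qed

lemma Phi_le: "Phi \<le> real n * (real d)\<^sup>2 * Kc + 16 * \<gamma>\<^sup>2 * real d * NP"
proof -
  let ?A = "\<lambda>j. {p. p \<in> {1..n} \<and> ancestor B p (parent B j)}"
  have "{1..n} = insert 1 {2..n}" using n by auto
  then have "Phi = Psi 1 + (\<Sum>j\<in>{2..n}. Psi j)"
    by (simp add: Phi_def)
  also have "Psi 1 = 0" by (simp add: Psi_def r_def)
  also have "0 + (\<Sum>j\<in>{2..n}. Psi j) \<le>
      (\<Sum>j\<in>{2..n}. (real d)\<^sup>2 * Kc + 16 * \<gamma>\<^sup>2 * real d * (\<Sum>p\<in>?A j. Bq p))"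
    unfolding add_0
  proof (rule sum_mono)
    fix j assume j: "j \<in> {2..n}"
    have dj: "real (depth B j) \<le> real d" using depth_le[of j] j by simp
    have "card (?A j) \<le> depth B j"
      using card_ancestor_le[of "parent B j" n B] parent_in[of j n B] depth_parent[of j B] j by simp
    then have card: "real (card (?A j)) \<le> real d" using dj by linarith
    have "Psi j \<le> real (depth B j) * (\<Sum>p\<in>?A j. K p)" by (rule Psi_le[OF j])
    also have "\<dots> \<le> real d * (\<Sum>p\<in>?A j. K p)"
      using dj nonneg(12) by (intro mult_right_mono sum_nonneg) auto
    also have "(\<Sum>p\<in>?A j. K p) = real (card (?A j)) * Kc + 16 * \<gamma>\<^sup>2 * (\<Sum>p\<in>?A j. Bq p)"
      by (simp add: K_def sum.distrib sum_distrib_left)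
    also have "real d * \<dots> \<le> real d * (real d * Kc + 16 * \<gamma>\<^sup>2 * (\<Sum>p\<in>?A j. Bq p))"
      using card nonneg(11) by (intro mult_left_mono add_mono mult_right_mono) auto
    finally show "Psi j \<le> (real d)\<^sup>2 * Kc + 16 * \<gamma>\<^sup>2 * real d * (\<Sum>p\<in>?A j. Bq p)"
      by (simp add: power2_eq_square algebra_simps)
  qed
  also have "\<dots> = real (n - 1) * (real d)\<^sup>2 * Kc + 16 * \<gamma>\<^sup>2 * real d * NP"
    by (simp add: NP_def sum.distrib sum_distrib_left)
  also have "\<dots> \<le> real n * (real d)\<^sup>2 * Kc + 16 * \<gamma>\<^sup>2 * real d * NP"
    using nonneg(11) by (intro add_right_mono mult_right_mono) auto
  finally show ?thesis .
qed

text \<open>With \<open>a = L * \<gamma> * n * d\<close> the stepsize condition is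
  \<open>a * d^2 \<le> 1/100\<close>, and \<open>\<kappa>\<close> is the square of \<open>a\<close>.
  This pays for factors up to \<open>d^2\<close> in front of \<open>\<kappa>\<close>.\<close>

lemma step_bounds:
  "0 \<le> \<kappa>" "10000 * \<kappa> \<le> 1" "10000 * (real d * \<kappa>) \<le> 1" "10000 * ((real d)\<^sup>2 * \<kappa>) \<le> 1"
  "100 * (L * \<gamma> * real n * real d) \<le> 1"
proof -
  define a where "a = L * \<gamma> * real n * real d"
  have a0: "0 \<le> a" using L \<gamma> by (simp add: a_def)
  have d1: "1 \<le> real d" using d by simp
  have a1: "a * (real d)\<^sup>2 \<le> 1 / 100"
    using step by (simp add: a_def power2_eq_square power3_eq_cube algebra_simps)
  have "a * 1 \<le> a * (real d)\<^sup>2"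
    using a0 d1 by (intro mult_left_mono) (simp_all add: one_le_power)
  then show "100 * (L * \<gamma> * real n * real d) \<le> 1"
    using a1 by (simp add: a_def)
  have \<kappa>: "\<kappa> = a\<^sup>2" by (simp add: \<kappa>_def a_def algebra_simps)
  show k0: "0 \<le> \<kappa>" by (simp add: \<kappa>)
  have "a * real d \<le> a * (real d)\<^sup>2"
    using a0 d1 by (intro mult_left_mono) (simp_all add: power2_eq_square)
  then have "(a * real d)\<^sup>2 \<le> (1 / 100)\<^sup>2"
    using a1 a0 by (intro power_mono) auto
  then show dd: "10000 * ((real d)\<^sup>2 * \<kappa>) \<le> 1"
    by (simp add: \<kappa> power_mult_distrib power2_eq_square algebra_simps)
  have "real d * \<kappa> \<le> (real d)\<^sup>2 * \<kappa>"
    using d1 k0 by (intro mult_right_mono) (simp_all add: power2_eq_square)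
  then show d: "10000 * (real d * \<kappa>) \<le> 1" using dd by simp
  have "1 * \<kappa> \<le> real d * \<kappa>"
    using d1 k0 by (intro mult_right_mono)
  then show "10000 * \<kappa> \<le> 1" using d by simp
qed

lemma rho_scaled_le: "(real n)\<^sup>2 * (real d)\<^sup>2 * L\<^sup>2 * \<rho> \<le> 2 * \<kappa> * (U + Bq 1)"
proof -
  have "(real n)\<^sup>2 * (real d)\<^sup>2 * L\<^sup>2 * \<rho> \<le>
      (real n)\<^sup>2 * (real d)\<^sup>2 * L\<^sup>2 * (2 * \<gamma>\<^sup>2 * (U + Bq 1))"
    by (intro mult_left_mono rho_le) simp
  also have "\<dots> = 2 * \<kappa> * (U + Bq 1)"
    by (simp add: \<kappa>_def power_mult_distrib)
  finally show ?thesis .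
qed

text \<open>\<open>Phi\<close> recurs on the right through \<open>WG\<close> with coefficient
  \<open>24 * \<kappa>\<close>. Moving it to the left only raises 16 to 17 and 4 to 5.\<close>

lemma Phi_scaled_le:
  "real n * L\<^sup>2 * Phi \<le> 17 * \<kappa> * (U + Bq 1) + 5 * \<kappa> * (real n * F0) + 17 * \<kappa> * (NP / (real n * real d))"
proof -
  let ?Q = "real n * L\<^sup>2 * Phi" and ?R = "(real n)\<^sup>2 * L\<^sup>2 * \<rho>"
  have d1: "1 \<le> (real d)\<^sup>2" using d by (simp add: one_le_power)
  have WG: "WG = 6 * ?Q + 3 * ?R + real n * F0"
    by (simp add: WG_def Phi_def F0_def sum.distrib sum_distrib_left power2_eq_square algebra_simps)
  have R: "?R \<le> 2 * \<kappa> * (U + Bq 1)"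
  proof -
    have "?R * 1 \<le> ?R * (real d)\<^sup>2" using d1 nonneg(3) by (intro mult_left_mono) auto
    then show ?thesis using rho_scaled_le by (simp add: mult_ac)
  qed
  have "?Q \<le> real n * L\<^sup>2 * (real n * (real d)\<^sup>2 * Kc + 16 * \<gamma>\<^sup>2 * real d * NP)"
    by (intro mult_left_mono Phi_le) simp
  also have "\<dots> = 8 * ((real n)\<^sup>2 * (real d)\<^sup>2 * L\<^sup>2 * \<rho>) + 4 * \<kappa> * WG + 16 * \<kappa> * (NP / (real n * real d))"
    using n d by (simp add: Kc_def \<kappa>_def power_mult_distrib power2_eq_square field_simps)
  also have "\<dots> \<le> 8 * (2 * \<kappa> * (U + Bq 1)) +
      4 * \<kappa> * (6 * ?Q + 3 * (2 * \<kappa> * (U + Bq 1)) + real n * F0) + 16 * \<kappa> * (NP / (real n * real d))"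
    unfolding WG using R rho_scaled_le step_bounds(1) by (intro add_mono mult_left_mono order_refl) auto
  finally have main: "?Q \<le> 16 * (\<kappa> * (U + Bq 1)) + 24 * (\<kappa> * ?Q) + 24 * (\<kappa> * (\<kappa> * (U + Bq 1))) +
      4 * (\<kappa> * (real n * F0)) + 16 * (\<kappa> * (NP / (real n * real d)))"
    by (simp add: algebra_simps)
  have small: "10000 * (\<kappa> * z) \<le> z" if "0 \<le> z" for z
    using mult_right_mono[OF step_bounds(2) that] by simp
  have Q0: "0 \<le> ?Q" using nonneg(5) by simp
  have V0: "0 \<le> \<kappa> * (U + Bq 1)" using nonneg(2) nonneg(6)[of 1] step_bounds(1) by simp
  have F0': "0 \<le> \<kappa> * (real n * F0)" using nonneg(7) step_bounds(1) by simp
  have P0: "0 \<le> \<kappa> * (NP / (real n * real d))" using nonneg(8) step_bounds(1) by simp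
  \<comment> \<open>Once the products are treated as independent reals, the absorption is a linear
    problem.\<close>
  have "a \<le> 17 * v + 5 * f + 17 * p"
    if "a \<le> 16 * v + 24 * ka + 24 * kv + 4 * f + 16 * p" "10000 * ka \<le> a" "10000 * kv \<le> v"
      "0 \<le> v" "0 \<le> f" "0 \<le> p" for a v ka kv f p :: real
    using that by linarith
  from this[OF main small[OF Q0] small[OF V0] V0 F0' P0] show ?thesis
    by (simp only: mult.assoc)
qed

section \<open>Comparing the root update with the true gradient\<close>

lemma sum_q_le: "(\<Sum>t\<le>T. (norm (q t))\<^sup>2) \<le> real n * L\<^sup>2 * Phi"
proof -
  have "(\<Sum>t\<le>T. (norm (q t))\<^sup>2) \<le> (\<Sum>t\<le>T. real n * (\<Sum>j=1..n. L\<^sup>2 * (norm (Z j t - r t))\<^sup>2))"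
  proof (rule sum_mono)
    fix t
    have "(norm (q t))\<^sup>2 \<le> real n * (\<Sum>j=1..n. (norm (G j (r t) - G j (Z j t)))\<^sup>2)"
      unfolding q_def by (rule norm_sum_sq_le) simp_all
    also have "\<dots> \<le> real n * (\<Sum>j=1..n. L\<^sup>2 * (norm (Z j t - r t))\<^sup>2)"
    proof (intro mult_left_mono sum_mono)
      fix j assume "j \<in> {1..n}"
      then have "norm (G j (r t) - G j (Z j t)) \<le> L * norm (Z j t - r t)"
        using lip[of j "r t" "Z j t"] by (simp add: norm_minus_commute)
      then show "(norm (G j (r t) - G j (Z j t)))\<^sup>2 \<le> L\<^sup>2 * (norm (Z j t - r t))\<^sup>2"
        by (metis norm_ge_zero power_mono power_mult_distrib)
    qed simp
    finally show "(norm (q t))\<^sup>2 \<le> real n * (\<Sum>j=1..n. L\<^sup>2 * (norm (Z j t - r t))\<^sup>2)" .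
  qed
  also have "\<dots> = real n * L\<^sup>2 * (\<Sum>t\<le>T. \<Sum>j=1..n. (norm (Z j t - r t))\<^sup>2)"
    by (simp add: sum_distrib_left mult.assoc)
  also have "(\<Sum>t\<le>T. \<Sum>j=1..n. (norm (Z j t - r t))\<^sup>2) = Phi"
    unfolding Phi_def Psi_def by (rule sum.swap)
  finally show ?thesis .
qed

lemma m_eq_0: "d \<le> t \<Longrightarrow> m t = 0"
  using depth_le unfolding m_def by (intro sum.neutral) (fastforce dest: le_trans)

lemma norm_m_le: "(norm (m t))\<^sup>2 \<le> real n * F0"
proof -
  have "(norm (m t))\<^sup>2 \<le> real n * (\<Sum>j=1..n. (norm (if depth B j \<le> t then 0 else G j x0))\<^sup>2)"
    unfolding m_def by (rule norm_sum_sq_le) simp_all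
  also have "\<dots> \<le> real n * F0"
    unfolding F0_def by (intro mult_left_mono sum_mono) auto
  finally show ?thesis .
qed

lemma sum_first_steps_le:
  assumes "\<And>t. t < d \<Longrightarrow> t \<le> T \<Longrightarrow> \<phi> t \<le> c" "\<And>t. d \<le> t \<Longrightarrow> \<phi> t \<le> 0" "0 \<le> (c::real)"
  shows "(\<Sum>t\<le>T. \<phi> t) \<le> real d * c"
proof -
  have "(\<Sum>t\<le>T. \<phi> t) \<le> (\<Sum>t\<le>T. if t < d then c else 0)"
    using assms(1,2) by (intro sum_mono) (auto simp: not_less)
  also have "\<dots> = real (card ({..T} \<inter> {t. t < d})) * c"
    by (simp add: sum.If_cases)
  also have "card ({..T} \<inter> {t. t < d}) \<le> card {..<d}"
    by (intro card_mono) auto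
  then have "real (card ({..T} \<inter> {t. t < d})) * c \<le> real d * c"
    using assms(3) by (intro mult_right_mono) auto
  finally show ?thesis .
qed

lemma sum_m_le: "(\<Sum>t\<le>T. (norm (m t))\<^sup>2) \<le> real d * (real n * F0)"
  by (rule sum_first_steps_le) (use norm_m_le m_eq_0 nonneg(7) in auto)

text \<open>An agent that has not started has \<open>Z j t = x0\<close>, so its gradient there is
  exactly its summand in \<open>m\<close>.\<close>

lemma split_gradient: "real n *\<^sub>R gF (r t) = u t + m t + q t"
proof -
  have "real n *\<^sub>R gF (r t) = (\<Sum>j=1..n. G j (Z j t)) + q t"
    by (simp add: gF q_def sum_subtractf)
  also have "(\<Sum>j=1..n. G j (Z j t)) = u t + m t"
    unfolding u_def m_def Gh_def sum.distrib[symmetric]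
    by (intro sum.cong refl) (simp add: Z_early)
  finally show ?thesis .
qed

lemma U_le: "U \<le> 3 * ((real n)\<^sup>2 * S) + 3 * (real n * L\<^sup>2 * Phi) + 3 * (real d * (real n * F0))"
proof -
  have "U \<le> (\<Sum>t\<le>T. 3 * ((real n)\<^sup>2 * (norm (gF (r t)))\<^sup>2) + 3 * (norm (q t))\<^sup>2 + 3 * (norm (m t))\<^sup>2)"
    unfolding U_def
  proof (rule sum_mono)
    fix t
    have "u t = real n *\<^sub>R gF (r t) + - q t + - m t"
      by (simp add: split_gradient)
    then show "(norm (u t))\<^sup>2 \<le>
        3 * ((real n)\<^sup>2 * (norm (gF (r t)))\<^sup>2) + 3 * (norm (q t))\<^sup>2 + 3 * (norm (m t))\<^sup>2"
      using norm_add3_sq_le[of "real n *\<^sub>R gF (r t)" "- q t" "- m t"]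
      by (simp add: power_mult_distrib)
  qed
  also have "\<dots> = 3 * ((real n)\<^sup>2 * S) + 3 * (\<Sum>t\<le>T. (norm (q t))\<^sup>2) + 3 * (\<Sum>t\<le>T. (norm (m t))\<^sup>2)"
    by (simp add: S_def sum.distrib sum_distrib_left)
  finally show ?thesis using sum_q_le sum_m_le by linarith
qed

lemma dist_start_le:
  assumes "t \<le> T" "t < d"
  shows "(norm (r t - x0))\<^sup>2 \<le> real d * \<rho>"
proof -
  have "r t - x0 = (\<Sum>s<t. r (Suc s) - r s)"
    by (subst sum_lessThan_telescope) (simp add: r_0)
  also have "(norm \<dots>)\<^sup>2 \<le> real d * (\<Sum>s<t. (norm (r (Suc s) - r s))\<^sup>2)"
    using assms by (intro norm_sum_sq_le) auto
  also have "(\<Sum>s<t. (norm (r (Suc s) - r s))\<^sup>2) = (\<Sum>s\<le>t. (norm (r s - r (s - 1)))\<^sup>2)"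
    by (simp add: sum.atMost_shift)
  also have "\<dots> \<le> \<rho>"
    unfolding \<rho>_def using assms by (intro sum_mono2) auto
  finally show ?thesis by (simp add: mult_left_mono)
qed

text \<open>In the first \<open>d\<close> steps some agents have not reached the root yet. Their missing gradients are paired
  with \<open>gF (r t)\<close>, which is still comparable to the gradient at the starting point and
  hence to \<open>L * \<Delta>\<close>; this keeps the constant in front of \<open>F0\<close> independent of \<open>d\<close>.\<close>

lemma sum_inner_m_le:
  "(\<Sum>t\<le>T. gF (r t) \<bullet> m t) \<le>
     8 * real n * (real d)\<^sup>2 * L * \<Delta> + 8 * (real d / real n) * (\<kappa> * (U + Bq 1)) + F0 / 8"
proof -
  \<comment> \<open>Weight for Young's inequality, chosen so that \<open>d\<close> rounds of the
    bound \<open>n * F0\<close> for the squared norm of \<open>m\<close> add up to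
    \<open>F0 / 8\<close>.\<close>
  have nd: "0 < 2 * real n * real d" using n d by simp
  have \<Delta>0: "0 \<le> \<Delta>" using low[of x0] by simp
  let ?c = "2 * real n * real d * (4 * L * \<Delta> + 2 * L\<^sup>2 * (real d * \<rho>)) + real n * F0 / (4 * (2 * real n * real d))"
  have "(\<Sum>t\<le>T. gF (r t) \<bullet> m t) \<le> real d * ?c"
  proof (rule sum_first_steps_le)
    fix t assume t: "t < d" "t \<le> T"
    have "norm (gF (r t) - gF x0) \<le> L * norm (r t - x0)" by (rule gF_lip)
    then have "(norm (gF (r t) - gF x0))\<^sup>2 \<le> L\<^sup>2 * (norm (r t - x0))\<^sup>2"
      by (metis norm_ge_zero power_mono power_mult_distrib)
    also have "\<dots> \<le> L\<^sup>2 * (real d * \<rho>)"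
      using dist_start_le t by (intro mult_left_mono) auto
    finally have "(norm (gF (r t)))\<^sup>2 \<le> 4 * L * \<Delta> + 2 * L\<^sup>2 * (real d * \<rho>)"
      using norm_add_sq_le[of "gF x0" "gF (r t) - gF x0"] grad0 by simp
    moreover have "gF (r t) \<bullet> m t \<le> 2 * real n * real d * (norm (gF (r t)))\<^sup>2 + (norm (m t))\<^sup>2 / (4 * (2 * real n * real d))"
      by (rule inner_le_weighted[OF nd])
    ultimately show "gF (r t) \<bullet> m t \<le> ?c"
      using norm_m_le[of t] nd
      by (elim order_trans) (intro add_mono mult_left_mono divide_right_mono; simp)
  next
    show "0 \<le> ?c" using L \<Delta>0 nonneg by (intro add_nonneg_nonneg mult_nonneg_nonneg divide_nonneg_nonneg) auto
  qed (simp add: m_eq_0)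
  also have "real d * ?c = 8 * real n * (real d)\<^sup>2 * L * \<Delta> +
      4 * (real d / real n) * ((real n)\<^sup>2 * (real d)\<^sup>2 * L\<^sup>2 * \<rho>) + F0 / 8"
    using n d by (simp add: power2_eq_square field_simps)
  also have "\<dots> \<le> 8 * real n * (real d)\<^sup>2 * L * \<Delta> +
      4 * (real d / real n) * (2 * \<kappa> * (U + Bq 1)) + F0 / 8"
    by (intro add_mono mult_left_mono rho_scaled_le order_refl) simp
  finally show ?thesis by simp
qed

text \<open>The quadratic cross term of \<open>u\<close> and \<open>N 1\<close> is removed by
  doubling, but the linear noise term is kept exact because its expectation will vanish.\<close>

lemma descent:
  "\<gamma> * (\<Sum>t\<le>T. gF (r t) \<bullet> u t) + \<gamma> * (\<Sum>t\<le>T. gF (r t) \<bullet> N 1 t) \<le> \<Delta> + L * \<gamma>\<^sup>2 * (U + Bq 1)"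
proof -
  have "F (r (Suc t)) - F (r t) \<le> - \<gamma> * (gF (r t) \<bullet> u t) - \<gamma> * (gF (r t) \<bullet> N 1 t) +
      L * \<gamma>\<^sup>2 * ((norm (u t))\<^sup>2 + (norm (N 1 t))\<^sup>2)" for t
  proof -
    have "F (r (Suc t)) \<le> F (r t) + gF (r t) \<bullet> (r (Suc t) - r t) + L / 2 * (norm (r (Suc t) - r t))\<^sup>2"
      by (rule smooth)
    moreover have "(norm (r (Suc t) - r t))\<^sup>2 = \<gamma>\<^sup>2 * (norm (u t + N 1 t))\<^sup>2"
      by (simp add: r_Suc power_mult_distrib)
    moreover have "L / 2 * (\<gamma>\<^sup>2 * (norm (u t + N 1 t))\<^sup>2) \<le>
        L / 2 * (\<gamma>\<^sup>2 * (2 * (norm (u t))\<^sup>2 + 2 * (norm (N 1 t))\<^sup>2))"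
      using L by (intro mult_left_mono norm_add_sq_le) auto
    ultimately show ?thesis
      by (simp add: r_Suc inner_add_right algebra_simps)
  qed
  then have "(\<Sum>t\<le>T. F (r (Suc t)) - F (r t)) \<le>
      (\<Sum>t\<le>T. - \<gamma> * (gF (r t) \<bullet> u t) - \<gamma> * (gF (r t) \<bullet> N 1 t) +
        L * \<gamma>\<^sup>2 * ((norm (u t))\<^sup>2 + (norm (N 1 t))\<^sup>2))"
    by (rule sum_mono)
  also have "\<dots> = - \<gamma> * (\<Sum>t\<le>T. gF (r t) \<bullet> u t) - \<gamma> * (\<Sum>t\<le>T. gF (r t) \<bullet> N 1 t) +
      L * \<gamma>\<^sup>2 * (U + Bq 1)"
    by (simp add: U_def Bq_def sum.distrib sum_subtractf sum_negf sum_distrib_left distrib_left)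
  also have "(\<Sum>t\<le>T. F (r (Suc t)) - F (r t)) = F (r (Suc T)) - F x0"
    using sum_lessThan_telescope[of "\<lambda>t. F (r t)" "Suc T"]
    by (simp only: lessThan_Suc_atMost r_0)
  finally show ?thesis using low[of "r (Suc T)"] by linarith
qed

text \<open>Here the circle closes: \<open>U\<close> is replaced through \<open>U_le\<close>,
  \<open>Phi\<close> through \<open>Phi_scaled_le\<close>, and all their returns to \<open>S\<close>
  are absorbed on the left.\<close>

lemma pathwise_bound:
  "7 / 10 * ((real n)\<^sup>2 * S) \<le> real n * \<Delta> / \<gamma> - real n * (\<Sum>t\<le>T. gF (r t) \<bullet> N 1 t) +
     8 * (real n)\<^sup>2 * (real d)\<^sup>2 * L * \<Delta> + real n * F0 / 5 +
     (27 * real d * \<kappa> + L * \<gamma> * real n) * Bq 1 + 19 * \<kappa> * (NP / (real n * real d))"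
proof -
  let ?Q = "real n * L\<^sup>2 * Phi" and ?C = "\<Sum>t\<le>T. gF (r t) \<bullet> N 1 t"
  let ?I = "\<Sum>t\<le>T. gF (r t) \<bullet> u t" and ?P = "NP / (real n * real d)"
  let ?V = "U + Bq 1" and ?nS = "(real n)\<^sup>2 * S" and ?nF = "real n * F0"
  have n0: "0 < real n" and d1: "1 \<le> real d" using n d by auto
  have "3 / 4 * real n * (norm (gF (r t)))\<^sup>2 - (norm (q t))\<^sup>2 / real n - gF (r t) \<bullet> m t \<le> gF (r t) \<bullet> u t" for t
  proof -
    \<comment> \<open>A quarter of the gradient term is spent on \<open>q\<close>; this is the
      origin of \<open>3 / 4\<close>.\<close>
    have "gF (r t) \<bullet> q t \<le> (real n / 4) * (norm (gF (r t)))\<^sup>2 + (norm (q t))\<^sup>2 / (4 * (real n / 4))"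
      using n0 by (intro inner_le_weighted) simp
    moreover have "gF (r t) \<bullet> u t = real n * (norm (gF (r t)))\<^sup>2 - gF (r t) \<bullet> q t - gF (r t) \<bullet> m t"
    proof -
      have "u t = real n *\<^sub>R gF (r t) - q t - m t" by (simp add: split_gradient)
      then show ?thesis by (simp add: inner_diff_right dot_square_norm)
    qed
    ultimately show ?thesis by simp
  qed
  then have "(\<Sum>t\<le>T. 3 / 4 * real n * (norm (gF (r t)))\<^sup>2 - (norm (q t))\<^sup>2 / real n - gF (r t) \<bullet> m t) \<le> ?I"
    by (rule sum_mono)
  moreover have "(\<Sum>t\<le>T. 3 / 4 * real n * (norm (gF (r t)))\<^sup>2 - (norm (q t))\<^sup>2 / real n - gF (r t) \<bullet> m t) =
      3 / 4 * real n * S - (\<Sum>t\<le>T. (norm (q t))\<^sup>2) / real n - (\<Sum>t\<le>T. gF (r t) \<bullet> m t)"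
    by (simp add: S_def sum_subtractf sum_distrib_left sum_divide_distrib)
  moreover have "(\<Sum>t\<le>T. (norm (q t))\<^sup>2) / real n \<le> ?Q / real n"
    using sum_q_le by (intro divide_right_mono) auto
  ultimately have I: "3 / 4 * real n * S - ?Q / real n -
      (8 * real n * (real d)\<^sup>2 * L * \<Delta> + 8 * (real d / real n) * (\<kappa> * ?V) + F0 / 8) \<le> ?I"
    using sum_inner_m_le by linarith
  have "?I + ?C \<le> \<Delta> / \<gamma> + L * \<gamma> * ?V"
  proof -
    have "(?I + ?C) * \<gamma> \<le> (\<Delta> / \<gamma> + L * \<gamma> * ?V) * \<gamma>"
      using descent \<gamma> by (simp add: algebra_simps power2_eq_square)
    then show ?thesis using \<gamma> by (simp only: mult_le_cancel_right)
  qed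
  then have "real n * (3 / 4 * real n * S - ?Q / real n -
      (8 * real n * (real d)\<^sup>2 * L * \<Delta> + 8 * (real d / real n) * (\<kappa> * ?V) + F0 / 8) + ?C) \<le>
      real n * (\<Delta> / \<gamma> + L * \<gamma> * ?V)"
    using I n0 by (intro mult_left_mono) auto
  then have main: "3 / 4 * ?nS \<le> real n * \<Delta> / \<gamma> - real n * ?C + 8 * (real n)\<^sup>2 * (real d)\<^sup>2 * L * \<Delta> +
      ?Q + ?nF / 8 + (8 * real d * \<kappa> + L * \<gamma> * real n) * ?V"
    using n0 by (simp add: algebra_simps power2_eq_square)
  define \<eta> where "\<eta> = 8 * real d * \<kappa> + L * \<gamma> * real n"
  have \<eta>0: "0 \<le> \<eta>" using L \<gamma> step_bounds(1) by (simp add: \<eta>_def)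
  \<comment> \<open>The sum \<open>8/10000 + 1/100\<close> rounded up. The factor \<open>d\<close>
    is included because \<open>U_le\<close> carries \<open>d * n * F0\<close>.\<close>
  have d\<eta>: "real d * \<eta> \<le> 11 / 1000"
    using step_bounds(4,5) by (simp add: \<eta>_def power2_eq_square algebra_simps)
  have \<eta>1: "\<eta> \<le> 11 / 1000"
    using mult_right_mono[OF d1 \<eta>0] d\<eta> by simp
  have nn: "0 \<le> ?nS" "0 \<le> ?Q" "0 \<le> ?nF" "0 \<le> U" "0 \<le> Bq 1" "0 \<le> ?P"
    using nonneg by auto
  have "\<eta> * U \<le> \<eta> * (3 * ?nS + 3 * ?Q + 3 * (real d * ?nF))"
    by (intro mult_left_mono U_le \<eta>0)
  also have "\<dots> = 3 * (\<eta> * ?nS) + 3 * (\<eta> * ?Q) + 3 * ((real d * \<eta>) * ?nF)"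
    by (simp add: algebra_simps)
  also have "\<dots> \<le> 3 * (11 / 1000 * ?nS) + 3 * (11 / 1000 * ?Q) + 3 * (11 / 1000 * ?nF)"
    using \<eta>1 d\<eta> nn by (intro add_mono mult_left_mono mult_right_mono) auto
  finally have \<eta>U: "\<eta> * U \<le> 33 / 1000 * ?nS + 33 / 1000 * ?Q + 33 / 1000 * ?nF" by simp
  have "\<kappa> * U \<le> \<kappa> * (3 * ?nS + 3 * ?Q + 3 * (real d * ?nF))"
    by (intro mult_left_mono U_le step_bounds(1))
  also have "\<dots> = 3 * (\<kappa> * ?nS) + 3 * (\<kappa> * ?Q) + 3 * ((real d * \<kappa>) * ?nF)"
    by (simp add: algebra_simps)
  also have "\<dots> \<le> 3 * (1 / 10000 * ?nS) + 3 * (1 / 10000 * ?Q) + 3 * (1 / 10000 * ?nF)"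
    using step_bounds(2,3) nn by (intro add_mono mult_left_mono mult_right_mono) auto
  finally have \<kappa>U: "\<kappa> * U \<le> 3 / 10000 * ?nS + 3 / 10000 * ?Q + 3 / 10000 * ?nF" by simp
  have \<kappa>F: "\<kappa> * ?nF \<le> 1 / 10000 * ?nF"
    using step_bounds(2) nn by (intro mult_right_mono) auto
  have \<kappa>B: "0 \<le> \<kappa> * Bq 1" "0 \<le> \<kappa> * ?P"
    using nn step_bounds(1) by (auto intro!: mult_nonneg_nonneg simp del: times_divide_eq_right)
  have Q: "?Q \<le> 17 * (\<kappa> * U) + 17 * (\<kappa> * Bq 1) + 5 * (\<kappa> * ?nF) + 17 * (\<kappa> * ?P)"
    using Phi_scaled_le by (simp add: algebra_simps)
  have Q': "?Q \<le> 6 / 1000 * ?nS + 6 / 1000 * ?nF + 18 * (\<kappa> * Bq 1) + 18 * (\<kappa> * ?P)"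
    using Q \<kappa>U \<kappa>F \<kappa>B nn by linarith
  have V: "\<eta> * ?V = \<eta> * U + \<eta> * Bq 1" by (simp add: algebra_simps)
  have dB: "\<kappa> * Bq 1 \<le> real d * (\<kappa> * Bq 1)"
    using mult_right_mono[OF d1 \<kappa>B(1)] by simp
  \<comment> \<open>The returns to \<open>?nS\<close> total less than \<open>4/100\<close>, within
    the gap from \<open>3/4\<close> to \<open>7/10\<close>; the coefficient of \<open>?nF\<close>
    grows from \<open>1/8\<close> to less than \<open>1/5\<close>, and 18 grows to less than
    19.\<close>
  have "7 / 10 * ?nS \<le> real n * \<Delta> / \<gamma> - real n * ?C + 8 * (real n)\<^sup>2 * (real d)\<^sup>2 * L * \<Delta> +
      ?nF / 5 + (19 * (real d * (\<kappa> * Bq 1)) + \<eta> * Bq 1) + 19 * (\<kappa> * ?P)"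
    using main Q' \<eta>U dB \<kappa>B nn unfolding \<eta>_def[symmetric] V by linarith
  also have "19 * (real d * (\<kappa> * Bq 1)) + \<eta> * Bq 1 = (27 * real d * \<kappa> + L * \<gamma> * real n) * Bq 1"
    by (simp add: \<eta>_def algebra_simps)
  finally show ?thesis by (simp only: mult.assoc)
qed

lemma pathwise_bound_explicit:
  "7 / 10 * ((real n)\<^sup>2 * (\<Sum>t\<le>T. (norm (gF (Z 1 t)))\<^sup>2)) \<le>
     real n * \<Delta> / \<gamma> + 8 * (real n)\<^sup>2 * (real d)\<^sup>2 * L * \<Delta> + real n * (\<Sum>i=1..n. (norm (G i x0))\<^sup>2) / 5 -
     real n * (\<Sum>t\<le>T. gF (Z 1 t) \<bullet> (\<Sum>l\<in>subtree n B 1. e l t)) +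
     (27 * real d * (\<gamma> * real n * L * real d)\<^sup>2 + L * \<gamma> * real n) *
       (\<Sum>t\<le>T. (norm (\<Sum>l\<in>subtree n B 1. e l t))\<^sup>2) +
     19 * (\<gamma> * real n * L * real d)\<^sup>2 / (real n * real d) *
       (\<Sum>j\<in>{2..n}. \<Sum>p | p \<in> {1..n} \<and> ancestor B p (parent B j). \<Sum>t\<le>T. (norm (\<Sum>l\<in>subtree n B p. e l t))\<^sup>2)"
  using pathwise_bound
  unfolding S_def F0_def Bq_def NP_def N_def \<kappa>_def r_def by simp

end

section \<open>Square-integrable random vectors\<close>

definition sqint :: "'w measure \<Rightarrow> ('w \<Rightarrow> 'a::euclidean_space) \<Rightarrow> bool" where
  "sqint M v \<longleftrightarrow> v \<in> borel_measurable M \<and> integrable M (\<lambda>\<omega>. (norm (v \<omega>))\<^sup>2)"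

lemma sqint_measurable: "sqint M v \<Longrightarrow> v \<in> borel_measurable M"
  and sqint_integrable: "sqint M v \<Longrightarrow> integrable M (\<lambda>\<omega>. (norm (v \<omega>))\<^sup>2)"
  by (simp_all add: sqint_def)

lemma sqint_scaleR: "sqint M v \<Longrightarrow> sqint M (\<lambda>\<omega>. c *\<^sub>R v \<omega>)"
  unfolding sqint_def power_mult_distrib norm_scaleR by (auto intro: borel_measurable_scaleR)

lemma sqint_add:
  assumes "sqint M v" "sqint M w"
  shows "sqint M (\<lambda>\<omega>. v \<omega> + w \<omega>)"
  unfolding sqint_def
proof
  show m: "(\<lambda>\<omega>. v \<omega> + w \<omega>) \<in> borel_measurable M"
    using assms by (intro borel_measurable_add sqint_measurable)
  show "integrable M (\<lambda>\<omega>. (norm (v \<omega> + w \<omega>))\<^sup>2)"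
  proof (rule Bochner_Integration.integrable_bound)
    show "integrable M (\<lambda>\<omega>. 2 * (norm (v \<omega>))\<^sup>2 + 2 * (norm (w \<omega>))\<^sup>2)"
      using assms[THEN sqint_integrable] by simp
    show "AE \<omega> in M. norm ((norm (v \<omega> + w \<omega>))\<^sup>2) \<le> norm (2 * (norm (v \<omega>))\<^sup>2 + 2 * (norm (w \<omega>))\<^sup>2)"
      using norm_add_sq_le by (intro AE_I2) (simp add: abs_of_nonneg)
  qed (use m in measurable)
qed

lemma sqint_diff: "sqint M v \<Longrightarrow> sqint M w \<Longrightarrow> sqint M (\<lambda>\<omega>. v \<omega> - w \<omega>)"
  using sqint_add[of M v "\<lambda>\<omega>. (- 1) *\<^sub>R w \<omega>"] sqint_scaleR[of M w "- 1"] by simp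

lemma sqint_0: "sqint M (\<lambda>\<omega>. 0)"
  by (simp add: sqint_def)

lemma sqint_sum: "(\<And>i. i \<in> A \<Longrightarrow> sqint M (v i)) \<Longrightarrow> sqint M (\<lambda>\<omega>. \<Sum>i\<in>A. v i \<omega>)"
  by (induction A rule: infinite_finite_induct) (auto intro: sqint_0 sqint_add)

lemma (in prob_space) sqint_const: "sqint M (\<lambda>\<omega>. c)"
  by (simp add: sqint_def)

lemma sqint_inner:
  fixes v w :: "'w \<Rightarrow> 'a::euclidean_space"
  assumes "sqint M v" "sqint M w"
  shows "integrable M (\<lambda>\<omega>. v \<omega> \<bullet> w \<omega>)"
proof (rule Bochner_Integration.integrable_bound)
  show "integrable M (\<lambda>\<omega>. (norm (v \<omega>))\<^sup>2 + (norm (w \<omega>))\<^sup>2)"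
    using assms[THEN sqint_integrable] by simp
  show "(\<lambda>\<omega>. v \<omega> \<bullet> w \<omega>) \<in> borel_measurable M"
    using assms by (intro borel_measurable_inner sqint_measurable)
  have "\<bar>a \<bullet> b\<bar> \<le> (norm a)\<^sup>2 + (norm b)\<^sup>2" for a b :: 'a
    using Cauchy_Schwarz_ineq2[of a b] sum_squares_bound[of "norm a" "norm b"]
      zero_le_power2[of "norm a"] zero_le_power2[of "norm b"] mult_nonneg_nonneg[of "norm a" "norm b"]
    by simp
  then show "AE \<omega> in M. norm (v \<omega> \<bullet> w \<omega>) \<le> norm ((norm (v \<omega>))\<^sup>2 + (norm (w \<omega>))\<^sup>2)"
    by (intro AE_I2) simp
qed

text \<open>After subtracting \<open>G 0\<close> the map grows at most linearly, and constants are
  square integrable on a probability space.\<close>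

lemma (in prob_space) sqint_lipschitz:
  assumes "L-lipschitz_on UNIV G" "sqint M v"
  shows "sqint M (\<lambda>\<omega>. G (v \<omega>))"
proof -
  have "continuous_on UNIV G"
    using assms(1) by (rule lipschitz_on_continuous_on)
  then have m: "(\<lambda>\<omega>. G (v \<omega>)) \<in> borel_measurable M"
    using sqint_measurable[OF assms(2)] by (auto intro: borel_measurable_continuous_on)
  have "sqint M (\<lambda>\<omega>. G (v \<omega>) - G 0)"
    unfolding sqint_def
  proof
    show m': "(\<lambda>\<omega>. G (v \<omega>) - G 0) \<in> borel_measurable M" using m by simp
    show "integrable M (\<lambda>\<omega>. (norm (G (v \<omega>) - G 0))\<^sup>2)"
    proof (rule Bochner_Integration.integrable_bound)
      show "integrable M (\<lambda>\<omega>. L\<^sup>2 * (norm (v \<omega>))\<^sup>2)"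
        using assms by (auto dest: sqint_integrable)
      have "(norm (G y - G 0))\<^sup>2 \<le> L\<^sup>2 * (norm y)\<^sup>2" for y
        using lipschitz_onD[OF assms(1), of y 0]
        by (metis UNIV_I dist_0_norm dist_commute dist_norm norm_ge_zero power_mono power_mult_distrib)
      then show "AE \<omega> in M. norm ((norm (G (v \<omega>) - G 0))\<^sup>2) \<le> norm (L\<^sup>2 * (norm (v \<omega>))\<^sup>2)"
        by (intro AE_I2) simp
    qed (use m' in measurable)
  qed
  then have "sqint M (\<lambda>\<omega>. (G (v \<omega>) - G 0) + G 0)"
    by (rule sqint_add[OF _ sqint_const])
  then show ?thesis by simp
qed

section \<open>Gradient noise\<close>

context prob_space
begin

text \<open>Disjoint index groups have a product law on the function spaces over \<open>J\<close>
  and \<open>{i}\<close>; evaluation at \<open>i\<close> turns the second factor into the law of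
  \<open>X i\<close>.\<close>

lemma distr_pair_of_indep:
  assumes ind: "indep_vars M' X I" and i: "i \<in> I" "i \<notin> J" and J: "J \<subseteq> I"
  shows "distr M (PiM J M') (\<lambda>\<omega>. restrict (\<lambda>i. X i \<omega>) J) \<Otimes>\<^sub>M distr M (M' i) (X i) =
    distr M (PiM J M' \<Otimes>\<^sub>M M' i) (\<lambda>\<omega>. (restrict (\<lambda>i. X i \<omega>) J, X i \<omega>))"
proof -
  let ?V = "\<lambda>\<omega>. restrict (\<lambda>i. X i \<omega>) J" and ?W = "\<lambda>\<omega>. restrict (\<lambda>i. X i \<omega>) {i}"
  have "indep_var (PiM J M') ?V (PiM {i} M') ?W"
    using i J by (intro indep_var_restrict[OF ind]) auto
  then have rv: "random_variable (PiM J M') ?V" "random_variable (PiM {i} M') ?W"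
    and joint: "distr M (PiM J M') ?V \<Otimes>\<^sub>M distr M (PiM {i} M') ?W =
      distr M (PiM J M' \<Otimes>\<^sub>M PiM {i} M') (\<lambda>\<omega>. (?V \<omega>, ?W \<omega>))"
    by (auto simp: indep_var_distribution_eq)
  have ev: "(\<lambda>v. v i) \<in> measurable (PiM {i} M') (M' i)" by simp
  have Xi: "random_variable (M' i) (X i)"
    using ind i by (auto simp: indep_vars_def)
  have W: "distr (distr M (PiM {i} M') ?W) (M' i) (\<lambda>v. v i) = distr M (M' i) (X i)"
    using ev rv(2) by (subst distr_distr) (simp_all add: comp_def)
  interpret Xi: prob_space "distr M (M' i) (X i)" by (rule prob_space_distr[OF Xi])
  have id: "distr (distr M (PiM J M') ?V) (PiM J M') (\<lambda>v. v) = distr M (PiM J M') ?V"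
    by (simp add: distr_id2)
  have "distr M (PiM J M') ?V \<Otimes>\<^sub>M distr M (M' i) (X i) =
      distr (distr M (PiM J M') ?V) (PiM J M') (\<lambda>v. v) \<Otimes>\<^sub>M
      distr (distr M (PiM {i} M') ?W) (M' i) (\<lambda>v. v i)"
    by (simp only: id W)
  also have "\<dots> = distr (distr M (PiM J M') ?V \<Otimes>\<^sub>M distr M (PiM {i} M') ?W) (PiM J M' \<Otimes>\<^sub>M M' i)
      (\<lambda>(v, v'). (v, v' i))"
    using ev Xi.sigma_finite_measure_axioms by (intro pair_measure_distr) (simp_all add: W)
  also have "\<dots> = distr M (PiM J M' \<Otimes>\<^sub>M M' i) (\<lambda>\<omega>. (?V \<omega>, X i \<omega>))"
    unfolding joint using rv ev by (subst distr_distr) (simp_all add: comp_def measurable_split_conv)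
  finally show ?thesis .
qed

text \<open>\<open>V\<close> plays the past, \<open>X\<close> a fresh sample and \<open>k\<close>
  the iterate as a function of the past. Through \<open>joint\<close>, Fubini's theorem takes the
  place of conditional expectations.\<close>

context
  fixes N :: "'c measure" and D :: "'s measure" and V :: "'a \<Rightarrow> 'c" and X :: "'a \<Rightarrow> 's"
    and g :: "'e::euclidean_space \<Rightarrow> 's \<Rightarrow> 'e" and G :: "'e \<Rightarrow> 'e" and k :: "'c \<Rightarrow> 'e" and \<sigma> :: real
  assumes V: "random_variable N V" and X: "random_variable D X"
    and joint: "distr M N V \<Otimes>\<^sub>M D = distr M (N \<Otimes>\<^sub>M D) (\<lambda>\<omega>. (V \<omega>, X \<omega>))"
    and D: "prob_space D"
    and g: "(\<lambda>(y, s). g y s) \<in> borel_measurable (borel \<Otimes>\<^sub>M D)"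
    and unbiased: "\<And>y. integrable D (g y) \<and> (\<integral>s. g y s \<partial>D) = G y"
    and var: "\<And>y. integrable D (\<lambda>s. (norm (g y s - G y))\<^sup>2) \<and>
        (\<integral>s. (norm (g y s - G y))\<^sup>2 \<partial>D) \<le> \<sigma>\<^sup>2"
    and k [measurable]: "k \<in> borel_measurable N" and G [measurable]: "G \<in> borel_measurable borel"
begin

private abbreviation (input) "P \<equiv> distr M N V"
private abbreviation (input) "H \<equiv> \<lambda>z. g (k (fst z)) (snd z) - G (k (fst z))"

lemma prob_space_P: "prob_space P"
  by (rule prob_space_distr[OF V])

lemma VX: "(\<lambda>\<omega>. (V \<omega>, X \<omega>)) \<in> measurable M (N \<Otimes>\<^sub>M D)"
  using V X by simp

lemma H_measurable: "H \<in> borel_measurable (N \<Otimes>\<^sub>M D)"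
proof -
  have "(\<lambda>z. (k (fst z), snd z)) \<in> measurable (N \<Otimes>\<^sub>M D) (borel \<Otimes>\<^sub>M D)" by measurable
  from measurable_compose[OF this g]
  have [measurable]: "(\<lambda>z. g (k (fst z)) (snd z)) \<in> borel_measurable (N \<Otimes>\<^sub>M D)" by simp
  show ?thesis by measurable
qed

text \<open>Nonnegative integrals are used because square integrability of the noise is not known
  yet; it is a consequence of this bound.\<close>

lemma nn_integral_noise_le: "(\<integral>\<^sup>+\<omega>. ennreal ((norm (g (k (V \<omega>)) (X \<omega>) - G (k (V \<omega>))))\<^sup>2) \<partial>M) \<le> ennreal (\<sigma>\<^sup>2)"
proof -
  interpret D: prob_space D by (rule D)
  interpret P: prob_space P by (rule prob_space_P)
  note [measurable] = H_measurable VX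
  have "(\<integral>\<^sup>+\<omega>. ennreal ((norm (g (k (V \<omega>)) (X \<omega>) - G (k (V \<omega>))))\<^sup>2) \<partial>M) =
      (\<integral>\<^sup>+z. ennreal ((norm (H z))\<^sup>2) \<partial>(P \<Otimes>\<^sub>M D))"
    unfolding joint by (subst nn_integral_distr) simp_all
  also have "\<dots> = (\<integral>\<^sup>+v. \<integral>\<^sup>+s. ennreal ((norm (H (v, s)))\<^sup>2) \<partial>D \<partial>P)"
    by (intro D.nn_integral_fst[symmetric]) simp
  also have "\<dots> \<le> (\<integral>\<^sup>+v. ennreal (\<sigma>\<^sup>2) \<partial>P)"
  proof (rule nn_integral_mono)
    fix v
    have "(\<integral>\<^sup>+s. ennreal ((norm (H (v, s)))\<^sup>2) \<partial>D) = ennreal (\<integral>s. (norm (g (k v) s - G (k v)))\<^sup>2 \<partial>D)"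
      using var[of "k v"] by (subst nn_integral_eq_integral) auto
    also have "\<dots> \<le> ennreal (\<sigma>\<^sup>2)" using var[of "k v"] by (intro ennreal_leI) auto
    finally show "(\<integral>\<^sup>+s. ennreal ((norm (H (v, s)))\<^sup>2) \<partial>D) \<le> ennreal (\<sigma>\<^sup>2)" .
  qed
  also have "\<dots> = ennreal (\<sigma>\<^sup>2)" using P.emeasure_space_1 by simp
  finally show ?thesis .
qed

lemma noise_measurable: "(\<lambda>\<omega>. g (k (V \<omega>)) (X \<omega>) - G (k (V \<omega>))) \<in> borel_measurable M"
  using measurable_compose[OF VX H_measurable] by simp

lemma sqint_noise: "sqint M (\<lambda>\<omega>. g (k (V \<omega>)) (X \<omega>) - G (k (V \<omega>)))"
  unfolding sqint_def
proof (intro conjI integrableI_bounded noise_measurable)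
  show "(\<integral>\<^sup>+\<omega>. ennreal (norm ((norm (g (k (V \<omega>)) (X \<omega>) - G (k (V \<omega>))))\<^sup>2)) \<partial>M) < \<infinity>"
    using nn_integral_noise_le by (simp add: order_le_less_trans)
qed (use noise_measurable in measurable)

lemma variance_noise_le: "(\<integral>\<omega>. (norm (g (k (V \<omega>)) (X \<omega>) - G (k (V \<omega>))))\<^sup>2 \<partial>M) \<le> \<sigma>\<^sup>2"
  by (rule integral_real_bounded[OF zero_le_power2 nn_integral_noise_le])

text \<open>For fixed past the integral over the fresh sample vanishes by unbiasedness. Square
  integrability of both factors justifies the iterated integral.\<close>

lemma integral_inner_noise:
  assumes \<psi> [measurable]: "\<psi> \<in> borel_measurable N" and sq: "sqint M (\<lambda>\<omega>. \<psi> (V \<omega>))"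
  shows "(\<integral>\<omega>. \<psi> (V \<omega>) \<bullet> (g (k (V \<omega>)) (X \<omega>) - G (k (V \<omega>))) \<partial>M) = 0"
proof -
  interpret D: prob_space D by (rule D)
  interpret P: prob_space P by (rule prob_space_P)
  interpret PD: pair_sigma_finite P D ..
  note [measurable] = H_measurable VX
  have m: "(\<lambda>z. \<psi> (fst z) \<bullet> H z) \<in> borel_measurable (N \<Otimes>\<^sub>M D)" by measurable
  have "integrable M (\<lambda>\<omega>. \<psi> (V \<omega>) \<bullet> (g (k (V \<omega>)) (X \<omega>) - G (k (V \<omega>))))"
    by (rule sqint_inner[OF sq sqint_noise])
  then have int: "integrable (P \<Otimes>\<^sub>M D) (\<lambda>z. \<psi> (fst z) \<bullet> H z)"
    unfolding joint using m by (subst integrable_distr_eq) simp_all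
  have "(\<integral>\<omega>. \<psi> (V \<omega>) \<bullet> (g (k (V \<omega>)) (X \<omega>) - G (k (V \<omega>))) \<partial>M) = (\<integral>z. \<psi> (fst z) \<bullet> H z \<partial>(P \<Otimes>\<^sub>M D))"
    unfolding joint using m by (subst integral_distr) simp_all
  also have "\<dots> = (\<integral>v. \<integral>s. \<psi> v \<bullet> (g (k v) s - G (k v)) \<partial>D \<partial>P)"
    using PD.integral_fst'[OF int] by simp
  also have "\<dots> = (\<integral>v. 0 \<partial>P)"
  proof (rule Bochner_Integration.integral_cong[OF refl])
    fix v
    have "(\<integral>s. \<psi> v \<bullet> (g (k v) s - G (k v)) \<partial>D) = \<psi> v \<bullet> (\<integral>s. g (k v) s - G (k v) \<partial>D)"
      using unbiased[of "k v"] by (intro integral_inner_right) auto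
    also have "(\<integral>s. g (k v) s - G (k v) \<partial>D) = 0"
      using unbiased[of "k v"] by (subst Bochner_Integration.integral_diff) (auto simp: D.prob_space)
    finally show "(\<integral>s. \<psi> v \<bullet> (g (k v) s - G (k v)) \<partial>D) = 0" by simp
  qed
  finally show ?thesis by simp
qed

end

end

lemma integral_norm_sum_sq_orthogonal:
  assumes "finite A" "\<And>i. i \<in> A \<Longrightarrow> sqint M (v i)"
    and "\<And>i j. i \<in> A \<Longrightarrow> j \<in> A \<Longrightarrow> i \<noteq> j \<Longrightarrow> (\<integral>\<omega>. v i \<omega> \<bullet> v j \<omega> \<partial>M) = 0"
  shows "(\<integral>\<omega>. (norm (\<Sum>i\<in>A. v i \<omega>))\<^sup>2 \<partial>M) = (\<Sum>i\<in>A. \<integral>\<omega>. (norm (v i \<omega>))\<^sup>2 \<partial>M)"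
proof -
  have "(\<integral>\<omega>. (norm (\<Sum>i\<in>A. v i \<omega>))\<^sup>2 \<partial>M) = (\<integral>\<omega>. (\<Sum>i\<in>A. \<Sum>j\<in>A. v i \<omega> \<bullet> v j \<omega>) \<partial>M)"
    by (simp only: power2_norm_eq_inner inner_sum_left) (simp only: inner_sum_right)
  also have "\<dots> = (\<Sum>i\<in>A. \<Sum>j\<in>A. \<integral>\<omega>. v i \<omega> \<bullet> v j \<omega> \<partial>M)"
    using assms(2) by (simp add: Bochner_Integration.integral_sum sqint_inner)
  also have "\<dots> = (\<Sum>i\<in>A. \<Sum>j\<in>A. if i = j then \<integral>\<omega>. (norm (v i \<omega>))\<^sup>2 \<partial>M else 0)"
    using assms(3) by (intro sum.cong refl) (auto simp: power2_norm_eq_inner)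
  also have "\<dots> = (\<Sum>i\<in>A. \<integral>\<omega>. (norm (v i \<omega>))\<^sup>2 \<partial>M)"
    using assms(1) by simp
  finally show ?thesis .
qed

section \<open>The noise of the iteration\<close>

locale btpp_sampling = prob_space M
  for M :: "'w measure" +
  fixes n B :: nat and \<gamma> L \<sigma> :: real
    and g :: "nat \<Rightarrow> real ^ 'p \<Rightarrow> 's \<Rightarrow> real ^ 'p" and G :: "nat \<Rightarrow> real ^ 'p \<Rightarrow> real ^ 'p"
    and D :: "nat \<Rightarrow> 's measure" and \<xi> :: "nat \<Rightarrow> nat \<Rightarrow> 'w \<Rightarrow> 's" and x0 :: "real ^ 'p"
  assumes B: "B \<ge> 1"
    and G_lip: "\<And>i. i \<in> {1..n} \<Longrightarrow> L-lipschitz_on UNIV (G i)"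
    and \<xi>_distr: "\<And>i t. i \<in> {1..n} \<Longrightarrow> distr M (D i) (\<xi> i t) = D i"
    and \<xi>_indep: "indep_vars (\<lambda>(i, t). D i) (\<lambda>(i, t). \<xi> i t) ({1..n} \<times> UNIV)"
    and g_measurable: "\<And>i. i \<in> {1..n} \<Longrightarrow> (\<lambda>(y, s). g i y s) \<in> borel_measurable (borel \<Otimes>\<^sub>M D i)"
    and g_unbiased: "\<And>i y. i \<in> {1..n} \<Longrightarrow> integrable (D i) (g i y) \<and> (\<integral>s. g i y s \<partial>D i) = G i y"
    and g_variance: "\<And>i y. i \<in> {1..n} \<Longrightarrow> integrable (D i) (\<lambda>s. (norm (g i y s - G i y))\<^sup>2) \<and>
          (\<integral>s. (norm (g i y s - G i y))\<^sup>2 \<partial>D i) \<le> \<sigma>\<^sup>2"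
begin

definition X where "X s t i = btppX n B \<gamma> g x0 s t i"

definition noise where "noise s i t = g i (X s t i) (s i t) - G i (X s t i)"

abbreviation sample where "sample \<omega> \<equiv> \<lambda>i t. \<xi> i t \<omega>"

text \<open>All samples up to the shifted time of \<open>(i, u)\<close>, including those of other
  agents at the very same shifted time: this gives orthogonality between agents and not only over
  time.\<close>

definition past where "past i u = {(l, v). l \<in> {1..n} \<and> v + depth B l \<le> u + depth B i} - {(i, u)}"

definition past_space where "past_space i u = PiM (past i u) (\<lambda>(l, v). D l)"

definition past_sample where "past_sample i u \<omega> = restrict (\<lambda>(l, v). \<xi> l v \<omega>) (past i u)"

lemma random_variable_\<xi>: "i \<in> {1..n} \<Longrightarrow> random_variable (D i) (\<xi> i t)"
  using \<xi>_indep unfolding indep_vars_def by fastforce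

lemma prob_space_D: "i \<in> {1..n} \<Longrightarrow> prob_space (D i)"
  using prob_space_distr[OF random_variable_\<xi>[of i 0]] by (simp add: \<xi>_distr)

lemma G_measurable: "i \<in> {1..n} \<Longrightarrow> G i \<in> borel_measurable borel"
  using lipschitz_on_continuous_on[OF G_lip] by (rule borel_measurable_continuous_onI)

lemma past_coordinate_measurable:
  "(l, v) \<in> past i u \<Longrightarrow> (\<lambda>p. p (l, v)) \<in> measurable (past_space i u) (D l)"
  unfolding past_space_def using measurable_component_singleton[of "(l, v)" "past i u" "\<lambda>(l, v). D l"] by simp

lemma past_sample_measurable: "random_variable (past_space i u) (past_sample i u)"
  unfolding past_space_def past_sample_def
  using random_variable_\<xi> by (intro measurable_restrict) (auto simp: past_def)

lemma past_sample_eq: "(l, v) \<in> past i u \<Longrightarrow> past_sample i u \<omega> (l, v) = \<xi> l v \<omega>"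
  by (simp add: past_sample_def)

lemma joint_past:
  assumes i: "i \<in> {1..n}"
  shows "distr M (past_space i u) (past_sample i u) \<Otimes>\<^sub>M D i =
    distr M (past_space i u \<Otimes>\<^sub>M D i) (\<lambda>\<omega>. (past_sample i u \<omega>, \<xi> i u \<omega>))"
proof -
  have "past i u \<subseteq> {1..n} \<times> UNIV" "(i, u) \<notin> past i u" "(i, u) \<in> {1..n} \<times> UNIV"
    using i by (auto simp: past_def)
  from distr_pair_of_indep[OF \<xi>_indep this(3,2,1)] \<xi>_distr[OF i]
  show ?thesis
    by (simp add: past_space_def past_sample_def[abs_def] case_prod_unfold)
qed

text \<open>The iterate sees only strictly smaller shifted times, so the recursion can be run on the
  past family alone, without the sample \<open>(i, u)\<close>.\<close>

lemma X_past_measurable: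
  assumes "l \<in> {1..n}" "v + depth B l \<le> u + depth B i"
  shows "(\<lambda>p. X (\<lambda>l v. p (l, v)) v l) \<in> borel_measurable (past_space i u)"
proof -
  have "(\<lambda>p. p (l', v')) \<in> measurable (past_space i u) (D l')"
    if "l' \<in> {1..n}" "v' + depth B l' < u + depth B i" for l' v'
    using that by (intro past_coordinate_measurable) (auto simp: past_def)
  from btpp_measurable[where s = "\<lambda>p l v. p (l, v)" and t = v, OF B this g_measurable assms(1)]
  show ?thesis using assms(2) by (simp add: X_def)
qed

lemma X_past_eq:
  assumes "l \<in> {1..n}" "v + depth B l \<le> u + depth B i"
  shows "X (\<lambda>l v. past_sample i u \<omega> (l, v)) v l = X (sample \<omega>) v l"
proof -
  have "past_sample i u \<omega> (l', v') = \<xi> l' v' \<omega>" if "l' \<in> {1..n}" "v' + depth B l' < u + depth B i" for l' v'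
    using that by (intro past_sample_eq) (auto simp: past_def)
  from btpp_cong[where s = "\<lambda>l v. past_sample i u \<omega> (l, v)" and t = v and \<gamma> = \<gamma> and g = g
      and K = "u + depth B i", OF B this assms(1)]
  show ?thesis using assms(2) by (simp add: X_def)
qed

context
  fixes i u :: nat assumes i: "i \<in> {1..n}"
begin

private lemmas noise_rules = past_sample_measurable[of i u] random_variable_\<xi>[OF i, of u] joint_past[OF i, of u]
  prob_space_D[OF i] g_measurable[OF i] g_unbiased[OF i] g_variance[OF i]
  X_past_measurable[OF i order_refl] G_measurable[OF i]

private lemma noise_eq:
  "noise (sample \<omega>) i u =
    g i (X (\<lambda>l v. past_sample i u \<omega> (l, v)) u i) (\<xi> i u \<omega>) - G i (X (\<lambda>l v. past_sample i u \<omega> (l, v)) u i)"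
  using X_past_eq[OF i order_refl] by (simp add: noise_def)

lemma sqint_btpp_noise: "sqint M (\<lambda>\<omega>. noise (sample \<omega>) i u)"
  unfolding noise_eq by (rule sqint_noise[OF noise_rules])

lemma variance_btpp_noise_le: "(\<integral>\<omega>. (norm (noise (sample \<omega>) i u))\<^sup>2 \<partial>M) \<le> \<sigma>\<^sup>2"
  unfolding noise_eq by (rule variance_noise_le[OF noise_rules])

lemma noise_orthogonal_past:
  assumes "\<psi> \<in> borel_measurable (past_space i u)" "\<And>\<omega>. \<psi> (past_sample i u \<omega>) = \<phi> \<omega>" "sqint M \<phi>"
  shows "(\<integral>\<omega>. \<phi> \<omega> \<bullet> noise (sample \<omega>) i u \<partial>M) = 0"
  using integral_inner_noise[OF noise_rules assms(1)] assms(2,3) by (simp add: noise_eq)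

lemma noise_orthogonal_iterate:
  assumes "l \<in> {1..n}" "v + depth B l \<le> u + depth B i"
    and H: "K-lipschitz_on UNIV H" and sq: "sqint M (\<lambda>\<omega>. X (sample \<omega>) v l)"
  shows "(\<integral>\<omega>. H (X (sample \<omega>) v l) \<bullet> noise (sample \<omega>) i u \<partial>M) = 0"
proof (rule noise_orthogonal_past)
  show "(\<lambda>p. H (X (\<lambda>l v. p (l, v)) v l)) \<in> borel_measurable (past_space i u)"
    using X_past_measurable[OF assms(1,2)] lipschitz_on_continuous_on[OF H]
    by (auto intro: borel_measurable_continuous_on)
qed (use X_past_eq[OF assms(1,2)] sqint_lipschitz[OF H sq] in auto)

text \<open>The noise at \<open>(l, v)\<close> also uses its own sample, possibly at equal shifted
  time; that sample lies in the past of \<open>(i, u)\<close> because the two index pairs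
  differ.\<close>

lemma noise_orthogonal_noise:
  assumes l: "l \<in> {1..n}" "v + depth B l \<le> u + depth B i" "(l, v) \<noteq> (i, u)"
  shows "(\<integral>\<omega>. noise (sample \<omega>) l v \<bullet> noise (sample \<omega>) i u \<partial>M) = 0"
proof (rule noise_orthogonal_past)
  have lv: "(l, v) \<in> past i u" using l by (auto simp: past_def)
  note X = X_past_measurable[OF l(1,2)]
  have "(\<lambda>p. g l (X (\<lambda>l v. p (l, v)) v l) (p (l, v))) \<in> borel_measurable (past_space i u)"
    using measurable_compose[OF measurable_Pair[OF X past_coordinate_measurable[OF lv]] g_measurable[OF l(1)]]
    by simp
  moreover have "(\<lambda>p. G l (X (\<lambda>l v. p (l, v)) v l)) \<in> borel_measurable (past_space i u)"
    by (rule measurable_compose[OF X G_measurable[OF l(1)]])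
  ultimately show "(\<lambda>p. noise (\<lambda>l v. p (l, v)) l v) \<in> borel_measurable (past_space i u)"
    unfolding noise_def by (rule borel_measurable_diff)
  show "noise (\<lambda>l v. past_sample i u \<omega> (l, v)) l v = noise (sample \<omega>) l v" for \<omega>
    using X_past_eq[OF l(1,2)] past_sample_eq[OF lv] by (simp add: noise_def)
qed (rule btpp_sampling.sqint_btpp_noise[OF btpp_sampling_axioms l(1)])

end

text \<open>Iterates and trackers feed each other and need a joint induction; a stochastic gradient
  is noise plus a Lipschitz image of the iterate.\<close>

lemma sqint_XY:
  "i \<in> {1..n} \<Longrightarrow> sqint M (\<lambda>\<omega>. X (sample \<omega>) t i) \<and> sqint M (\<lambda>\<omega>. btppY n B \<gamma> g x0 (sample \<omega>) t i)"
proof (induction t arbitrary: i)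
  case 0
  have X: "sqint M (\<lambda>\<omega>. X (sample \<omega>) 0 i)" by (simp add: X_def sqint_const)
  have "sqint M (\<lambda>\<omega>. noise (sample \<omega>) i 0 + G i (X (sample \<omega>) 0 i))"
    by (intro sqint_add sqint_btpp_noise sqint_lipschitz[OF G_lip X] 0)
  then show ?case using X by (simp add: noise_def X_def)
next
  case (Suc t)
  have g: "sqint M (\<lambda>\<omega>. g i (X (sample \<omega>) u i) (\<xi> i u \<omega>))" if "sqint M (\<lambda>\<omega>. X (sample \<omega>) u i)" for u
    using sqint_add[OF sqint_btpp_noise[OF Suc.prems, of u] sqint_lipschitz[OF G_lip[OF Suc.prems] that]]
    by (simp add: noise_def)
  have X: "sqint M (\<lambda>\<omega>. X (sample \<omega>) (Suc t) i)"
    unfolding X_def btppX_Suc[OF B Suc.prems]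
    using Suc.IH[OF parent_in[OF Suc.prems]] by (intro sqint_diff sqint_scaleR) (auto simp: X_def)
  have "sqint M (\<lambda>\<omega>. \<Sum>c\<in>children n B i. btppY n B \<gamma> g x0 (sample \<omega>) t c)"
    using Suc.IH by (intro sqint_sum) (auto simp: children_def)
  moreover have "sqint M (\<lambda>\<omega>. if i = 1 then btppY n B \<gamma> g x0 (sample \<omega>) t 1 else 0)"
    using Suc.IH[of 1] Suc.prems by (cases "i = 1") (auto intro: sqint_0)
  ultimately have "sqint M (\<lambda>\<omega>. btppY n B \<gamma> g x0 (sample \<omega>) (Suc t) i)"
    unfolding btppY_Suc[OF B Suc.prems]
    using g[OF X] g[of t] Suc.IH[OF Suc.prems] by (intro sqint_add sqint_diff) (auto simp: X_def)
  with X show ?case by blast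
qed

lemmas sqint_X = sqint_XY[THEN conjunct1]

text \<open>The shifted noise \<open>e\<close> at time \<open>t\<close> is centred given everything that determines the root iterate
  at time \<open>t\<close>: a sample of agent \<open>j\<close> needs \<open>depth B j\<close> rounds to reach the root.\<close>

definition e where "e \<omega> j t = (if depth B j \<le> t then noise (sample \<omega>) j (t - depth B j) else 0)"

lemma sqint_e: "j \<in> {1..n} \<Longrightarrow> sqint M (\<lambda>\<omega>. e \<omega> j t)"
  unfolding e_def by (cases "depth B j \<le> t") (simp_all add: sqint_btpp_noise sqint_0)

lemma sqint_sum_e: "sqint M (\<lambda>\<omega>. \<Sum>l\<in>subtree n B p. e \<omega> l t)"
  using subtree_subset by (intro sqint_sum sqint_e) blast

text \<open>Orthogonality between agents yields the factor \<open>n\<close>, the source of the gain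
  from averaging over agents.\<close>

lemma integral_sum_e_sq_le:
  "(\<integral>\<omega>. (norm (\<Sum>l\<in>subtree n B p. e \<omega> l t))\<^sup>2 \<partial>M) \<le> real n * \<sigma>\<^sup>2"
proof -
  have sub: "l \<in> {1..n}" if "l \<in> subtree n B p" for l using that subtree_subset by blast
  have "(\<integral>\<omega>. e \<omega> l t \<bullet> e \<omega> i t \<partial>M) = 0" if "l \<in> {1..n}" "i \<in> {1..n}" "l \<noteq> i" for l i
    using that noise_orthogonal_noise[of i l "t - depth B l" "t - depth B i"]
    by (cases "depth B l \<le> t"; cases "depth B i \<le> t") (simp_all add: e_def)
  then have "(\<integral>\<omega>. (norm (\<Sum>l\<in>subtree n B p. e \<omega> l t))\<^sup>2 \<partial>M) =
      (\<Sum>l\<in>subtree n B p. \<integral>\<omega>. (norm (e \<omega> l t))\<^sup>2 \<partial>M)"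
    using sub by (intro integral_norm_sum_sq_orthogonal sqint_e) auto
  also have "\<dots> \<le> (\<Sum>l\<in>subtree n B p. \<sigma>\<^sup>2)"
  proof (rule sum_mono)
    fix l assume "l \<in> subtree n B p"
    then show "(\<integral>\<omega>. (norm (e \<omega> l t))\<^sup>2 \<partial>M) \<le> \<sigma>\<^sup>2"
      using variance_btpp_noise_le[OF sub] by (cases "depth B l \<le> t") (simp_all add: e_def)
  qed
  also have "\<dots> \<le> real n * \<sigma>\<^sup>2"
    using card_mono[OF _ subtree_subset[of n B p]] by (simp add: mult_right_mono)
  finally show ?thesis .
qed

text \<open>The root at time \<open>t\<close> and the sample of \<open>l\<close> at time
  \<open>t - depth B l\<close> both have shifted time \<open>t\<close>, the borderline case in which
  the iterate is still a function of the past.\<close>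

lemma integral_root_inner_e:
  assumes "n \<ge> 1" and H: "K-lipschitz_on UNIV H"
  shows "(\<integral>\<omega>. H (X (sample \<omega>) t 1) \<bullet> (\<Sum>l\<in>subtree n B 1. e \<omega> l t) \<partial>M) = 0"
proof -
  have sub: "l \<in> {1..n}" if "l \<in> subtree n B 1" for l using that subtree_subset by blast
  have X: "sqint M (\<lambda>\<omega>. H (X (sample \<omega>) t 1))"
    using assms(1) by (intro sqint_lipschitz[OF H] sqint_X) simp
  have "(\<integral>\<omega>. H (X (sample \<omega>) t 1) \<bullet> e \<omega> l t \<partial>M) = 0" if "l \<in> {1..n}" for l
    using noise_orthogonal_iterate[OF that _ _ H sqint_X, of 1 t "t - depth B l"] assms(1)
    by (cases "depth B l \<le> t") (simp_all add: e_def)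
  then show ?thesis
    using sub X by (simp add: inner_sum_right Bochner_Integration.integral_sum sqint_inner sqint_e
        del: One_nat_def)
qed

lemma delayed_descent_sample:
  assumes "n \<ge> 1" "d \<ge> 1" "L > 0" "\<gamma> > 0" "\<And>i. i \<in> {1..n} \<Longrightarrow> depth B i \<le> d"
    and "100 * real n * real d ^ 3 * L * \<gamma> \<le> 1"
    and "\<And>y. real n *\<^sub>R gF y = (\<Sum>i=1..n. G i y)"
    and "\<And>y z. F z \<le> F y + gF y \<bullet> (z - y) + L / 2 * (norm (z - y))\<^sup>2"
    and "L-lipschitz_on UNIV gF"
    and "\<And>y. F x0 - \<Delta> \<le> F y" and "(norm (gF x0))\<^sup>2 \<le> 2 * L * \<Delta>"
  shows "delayed_descent n d B L \<gamma> \<Delta> F G gF x0 (shiftX n B \<gamma> g x0 (sample \<omega>)) (e \<omega>)"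
proof -
  have h: "(if depth B j \<le> t then G j (shiftX n B \<gamma> g x0 (sample \<omega>) j t) else 0) + e \<omega> j t =
      shiftG n B \<gamma> g x0 (sample \<omega>) j t" for j t
    using B by (simp add: shiftG_def shiftX_def e_def noise_def X_def)
  show ?thesis
  proof
    show "norm (G i y - G i z) \<le> L * norm (y - z)" if "i \<in> {1..n}" for i y z
      using lipschitz_onD[OF G_lip[OF that], of y z] by (simp add: dist_norm)
    show "norm (gF y - gF z) \<le> L * norm (y - z)" for y z
      using lipschitz_onD[OF assms(9), of y z] by (simp add: dist_norm)
    show "e \<omega> j t = 0" if "t < depth B j" for j t
      using that by (simp add: e_def)
    show "shiftX n B \<gamma> g x0 (sample \<omega>) 1 (Suc t) = shiftX n B \<gamma> g x0 (sample \<omega>) 1 t -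
        \<gamma> *\<^sub>R (\<Sum>j=1..n. (if depth B j \<le> t then G j (shiftX n B \<gamma> g x0 (sample \<omega>) j t) else 0) + e \<omega> j t)" for t
      unfolding h by (rule shiftX_root_Suc[OF B assms(1)])
    show "shiftX n B \<gamma> g x0 (sample \<omega>) j t = shiftX n B \<gamma> g x0 (sample \<omega>) (parent B j) (t - 2) -
        \<gamma> *\<^sub>R (\<Sum>l\<in>subtree n B (parent B j).
          ((if depth B l \<le> t - 2 then G l (shiftX n B \<gamma> g x0 (sample \<omega>) l (t - 2)) else 0) + e \<omega> l (t - 2)) -
          ((if depth B l \<le> t - 2 - 1 then G l (shiftX n B \<gamma> g x0 (sample \<omega>) l (t - 2 - 1)) else 0)
            + e \<omega> l (t - 2 - 1)))"
      if "j \<in> {2..n}" "parent B j \<noteq> 1" for j t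
      unfolding h by (rule shiftX_nonroot[OF B that])
  qed (use assms in \<open>simp_all only: shiftX_early[OF B] shiftX_child_of_root[OF B]\<close>)
qed

text \<open>Only noise functionals are estimated in expectation, and the linear one has mean zero.
  The constant 46 is 27 from the root noise plus 19 from the noise along the paths.\<close>

lemma expected_bound:
  assumes n: "n \<ge> 1" and d: "d \<ge> 1" and L: "L > 0" and \<gamma>: "\<gamma> > 0"
    and depth_le: "\<And>i. i \<in> {1..n} \<Longrightarrow> depth B i \<le> d"
    and step: "100 * real n * real d ^ 3 * L * \<gamma> \<le> 1"
    and gF: "\<And>y. real n *\<^sub>R gF y = (\<Sum>i=1..n. G i y)"
    and smooth: "\<And>y z. F z \<le> F y + gF y \<bullet> (z - y) + L / 2 * (norm (z - y))\<^sup>2"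
    and gF_lip: "L-lipschitz_on UNIV gF"
    and low: "\<And>y. F x0 - \<Delta> \<le> F y" and grad0: "(norm (gF x0))\<^sup>2 \<le> 2 * L * \<Delta>"
  shows "7 / 10 * ((real n)\<^sup>2 * (\<Sum>t\<le>T. \<integral>\<omega>. (norm (gF (X (sample \<omega>) t 1)))\<^sup>2 \<partial>M)) \<le>
     real n * \<Delta> / \<gamma> + 8 * (real n)\<^sup>2 * (real d)\<^sup>2 * L * \<Delta> + real n * (\<Sum>i=1..n. (norm (G i x0))\<^sup>2) / 5 +
     (46 * real d * (\<gamma> * real n * L * real d)\<^sup>2 + L * \<gamma> * real n) * (real (Suc T) * (real n * \<sigma>\<^sup>2))"
proof -
  define b where "b p \<omega> = (\<Sum>t\<le>T. (norm (\<Sum>l\<in>subtree n B p. e \<omega> l t))\<^sup>2)" for p \<omega>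
  define c where "c \<omega> = (\<Sum>t\<le>T. gF (X (sample \<omega>) t 1) \<bullet> (\<Sum>l\<in>subtree n B 1. e \<omega> l t))" for \<omega>
  let ?A = "\<lambda>j. {p. p \<in> {1..n} \<and> ancestor B p (parent B j)}"
  define h where "h \<omega> = (\<Sum>j\<in>{2..n}. \<Sum>p\<in>?A j. b p \<omega>)" for \<omega>
  let ?\<kappa> = "(\<gamma> * real n * L * real d)\<^sup>2" and ?v = "real (Suc T) * (real n * \<sigma>\<^sup>2)"
  define c0 where "c0 = real n * \<Delta> / \<gamma> + 8 * (real n)\<^sup>2 * (real d)\<^sup>2 * L * \<Delta> +
    real n * (\<Sum>i=1..n. (norm (G i x0))\<^sup>2) / 5"
  define c1 where "c1 = 27 * real d * ?\<kappa> + L * \<gamma> * real n"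
  define c2 where "c2 = 19 * ?\<kappa> / (real n * real d)"
  have c1: "0 \<le> c1" and c2: "0 \<le> c2" using L \<gamma> by (simp_all add: c1_def c2_def)
  have root: "X (sample \<omega>) t 1 = shiftX n B \<gamma> g x0 (sample \<omega>) 1 t" for \<omega> t
    using B by (simp add: shiftX_def X_def)
  have path: "7 / 10 * ((real n)\<^sup>2 * (\<Sum>t\<le>T. (norm (gF (X (sample \<omega>) t 1)))\<^sup>2)) \<le>
      c0 - real n * c \<omega> + c1 * b 1 \<omega> + c2 * h \<omega>" for \<omega>
    unfolding root c0_def c1_def c2_def c_def b_def h_def
    using delayed_descent.pathwise_bound_explicit[OF delayed_descent_sample[OF assms, of \<omega>], of T] .
  have sq: "sqint M (\<lambda>\<omega>. gF (X (sample \<omega>) t 1))" for t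
    using n by (intro sqint_lipschitz[OF gF_lip] sqint_X) simp
  have c_int: "integrable M c" and c_0: "integral\<^sup>L M c = 0"
  proof -
    have i: "integrable M (\<lambda>\<omega>. gF (X (sample \<omega>) t 1) \<bullet> (\<Sum>l\<in>subtree n B 1. e \<omega> l t))" for t
      by (intro sqint_inner sq sqint_sum_e)
    then show "integrable M c" unfolding c_def[abs_def] by (intro Bochner_Integration.integrable_sum)
    show "integral\<^sup>L M c = 0"
      unfolding c_def[abs_def] using i
      by (subst Bochner_Integration.integral_sum) (simp_all only: integral_root_inner_e[OF n gF_lip] sum.neutral_const)
  qed
  have e_int: "integrable M (\<lambda>\<omega>. (norm (\<Sum>l\<in>subtree n B p. e \<omega> l t))\<^sup>2)" for p t
    by (rule sqint_integrable[OF sqint_sum_e])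
  have b_int: "integrable M (b p)" for p
    unfolding b_def[abs_def] by (intro Bochner_Integration.integrable_sum e_int)
  have b_le: "integral\<^sup>L M (b p) \<le> ?v" for p
  proof -
    have "integral\<^sup>L M (b p) = (\<Sum>t\<le>T. \<integral>\<omega>. (norm (\<Sum>l\<in>subtree n B p. e \<omega> l t))\<^sup>2 \<partial>M)"
      unfolding b_def[abs_def] by (intro Bochner_Integration.integral_sum e_int)
    also have "\<dots> \<le> (\<Sum>t\<le>T. real n * \<sigma>\<^sup>2)"
      by (intro sum_mono integral_sum_e_sq_le)
    finally show ?thesis by simp
  qed
  have h_int: "integrable M h"
    unfolding h_def[abs_def] by (intro Bochner_Integration.integrable_sum b_int)
  \<comment> \<open>\<open>h\<close> has at most \<open>n * d\<close> summands, which cancels the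
    denominator of \<open>c2\<close>.\<close>
  have h_le: "integral\<^sup>L M h \<le> real n * real d * ?v"
  proof -
    have v: "0 \<le> ?v" by simp
    have "integral\<^sup>L M h = (\<Sum>j\<in>{2..n}. \<Sum>p\<in>?A j. integral\<^sup>L M (b p))"
      unfolding h_def[abs_def]
      by (simp add: Bochner_Integration.integral_sum Bochner_Integration.integrable_sum b_int)
    also have "\<dots> \<le> (\<Sum>j\<in>{2..n}. real d * ?v)"
    proof (rule sum_mono)
      fix j assume j: "j \<in> {2..n}"
      have "card (?A j) \<le> depth B j"
        using card_ancestor_le[of "parent B j" n B] parent_in[of j n B] depth_parent[of j B] j by simp
      then have card: "real (card (?A j)) \<le> real d" using depth_le[of j] j by simp
      have "(\<Sum>p\<in>?A j. integral\<^sup>L M (b p)) \<le> (\<Sum>p\<in>?A j. ?v)" by (intro sum_mono b_le)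
      also have "\<dots> = real (card (?A j)) * ?v" by simp
      also have "\<dots> \<le> real d * ?v" using card v by (rule mult_right_mono)
      finally show "(\<Sum>p\<in>?A j. integral\<^sup>L M (b p)) \<le> real d * ?v" .
    qed
    also have "\<dots> = real (n - 1) * (real d * ?v)" by simp
    also have "\<dots> \<le> real n * (real d * ?v)" by (intro mult_right_mono) auto
    finally show ?thesis by (simp add: mult.assoc)
  qed
  have g_int: "integrable M (\<lambda>\<omega>. (norm (gF (X (sample \<omega>) t 1)))\<^sup>2)" for t
    by (rule sqint_integrable[OF sq])
  have "7 / 10 * ((real n)\<^sup>2 * (\<Sum>t\<le>T. \<integral>\<omega>. (norm (gF (X (sample \<omega>) t 1)))\<^sup>2 \<partial>M)) =
      (\<integral>\<omega>. 7 / 10 * ((real n)\<^sup>2 * (\<Sum>t\<le>T. (norm (gF (X (sample \<omega>) t 1)))\<^sup>2)) \<partial>M)"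
    using g_int by (simp add: Bochner_Integration.integral_sum Bochner_Integration.integrable_sum)
  also have "\<dots> \<le> (\<integral>\<omega>. c0 - real n * c \<omega> + c1 * b 1 \<omega> + c2 * h \<omega> \<partial>M)"
    using g_int c_int b_int h_int path
    by (intro integral_mono Bochner_Integration.integrable_add Bochner_Integration.integrable_diff
        integrable_mult_right Bochner_Integration.integrable_sum integrable_const)
  also have "\<dots> = c0 + c1 * integral\<^sup>L M (b 1) + c2 * integral\<^sup>L M h"
    using c_int b_int h_int c_0 by (simp add: prob_space)
  also have "\<dots> \<le> c0 + c1 * ?v + c2 * (real n * real d * ?v)"
    using b_le h_le c1 c2 by (intro add_mono mult_left_mono order_refl)
  also have "c2 * (real n * real d * ?v) = 19 * ?\<kappa> * ?v"
    using n d by (simp add: c2_def)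
  also have "c0 + c1 * ?v + 19 * ?\<kappa> * ?v \<le> c0 + (46 * real d * ?\<kappa> + L * \<gamma> * real n) * ?v"
  proof -
    have "1 * (?\<kappa> * ?v) \<le> real d * (?\<kappa> * ?v)"
      using d by (intro mult_right_mono) auto
    then show ?thesis by (simp add: c1_def algebra_simps)
  qed
  finally show ?thesis unfolding c0_def .
qed

end

section \<open>The choice of the stepsize\<close>

lemma powr_third_cube: "0 \<le> x \<Longrightarrow> (x powr (1/3)) ^ 3 = (x::real)"
  and powr_two_thirds_cube: "0 \<le> x \<Longrightarrow> (x powr (2/3)) ^ 3 = x\<^sup>2"
proof -
  assume x: "0 \<le> x"
  have *: "(x powr a) ^ 3 = x powr (a * 3)" for a
    using powr_numeral[of "x powr a" "num.Bit1 num.One"] by (simp add: powr_powr)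
  show "(x powr (1/3)) ^ 3 = x" "(x powr (2/3)) ^ 3 = x\<^sup>2"
    unfolding * using x by simp_all
qed

text \<open>\<open>1 / \<gamma>\<close> is at most the sum of the reciprocals of the three
  candidates, while each positive power of \<open>\<gamma>\<close> is bounded by the one candidate
  that balances it.\<close>

lemma stepsize_bound:
  fixes n d T :: nat and L \<sigma> \<gamma> \<Delta> E F0 :: real
  defines "\<tau> \<equiv> real T + 1"
  assumes n: "n \<ge> 1" and d: "d \<ge> 1" and L: "L > 0" and \<sigma>: "\<sigma>\<^sup>2 > 0" and \<Delta>: "\<Delta> > 0" and F0: "0 \<le> F0"
    and \<gamma>: "\<gamma> = Min {(\<Delta> / (3 * \<sigma>\<^sup>2 * L * real n * \<tau>)) powr (1/2),
                     (\<Delta> / (1500 * real n ^ 2 * real d ^ 6 * \<sigma>\<^sup>2 * L\<^sup>2 * \<tau>)) powr (1/3),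
                     1 / (100 * real n * real d ^ 3 * L)}"
    and E: "7 / 10 * ((real n)\<^sup>2 * E) \<le>
       real n * \<Delta> / \<gamma> + 8 * (real n)\<^sup>2 * (real d)\<^sup>2 * L * \<Delta> + real n * F0 / 5 +
       (46 * real d * (\<gamma> * real n * L * real d)\<^sup>2 + L * \<gamma> * real n) * (\<tau> * (real n * \<sigma>\<^sup>2))"
  shows "1 / \<tau> * E \<le> 32 * sqrt (\<Delta> * \<sigma>\<^sup>2 * L) / sqrt (real n * \<tau>)
           + 240 * real d ^ 2 * (\<sigma>\<^sup>2 * L\<^sup>2 * \<Delta>\<^sup>2) powr (1/3) / (sqrt (real n) * \<tau>) powr (2/3)
           + 800 * real d ^ 3 * L * \<Delta> / \<tau> + F0 / (real n * \<tau>)"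
proof -
  define N \<delta> s where "N = real n" and "\<delta> = real d" and "s = \<sigma>\<^sup>2"
  define a where "a = (\<Delta> / (3 * s * L * N * \<tau>)) powr (1/2)"
  define b where "b = (\<Delta> / (1500 * N ^ 2 * \<delta> ^ 6 * s * L\<^sup>2 * \<tau>)) powr (1/3)"
  define c where "c = 1 / (100 * N * \<delta> ^ 3 * L)"
  have pos: "0 < N" "1 \<le> \<delta>" "0 < \<delta>" "0 < s" "0 < \<tau>"
    using n d \<sigma> by (simp_all add: N_def \<delta>_def s_def \<tau>_def)
  have a0: "0 < a" and b0: "0 < b" and c0: "0 < c"
    using pos L \<Delta> by (simp_all add: a_def b_def c_def)
  have \<gamma>': "\<gamma> = Min {a, b, c}" using \<gamma> by (simp only: a_def b_def c_def N_def \<delta>_def s_def)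
  then have \<gamma>0: "0 < \<gamma>" and \<gamma>a: "\<gamma> \<le> a" and \<gamma>b: "\<gamma> \<le> b"
    using a0 b0 c0 by auto
  have inv: "1 / \<gamma> \<le> 1 / a + 1 / b + 1 / c"
  proof -
    have "\<gamma> \<in> {a, b, c}" unfolding \<gamma>' by (rule Min_in) auto
    then show ?thesis using a0 b0 c0 by auto
  qed
  have a2: "a\<^sup>2 = \<Delta> / (3 * s * L * N * \<tau>)"
    using pos L \<Delta> by (simp add: a_def powr_half_sqrt)
  have b3: "b ^ 3 = \<Delta> / (1500 * N ^ 2 * \<delta> ^ 6 * s * L\<^sup>2 * \<tau>)"
    using pos L \<Delta> unfolding b_def by (intro powr_third_cube) simp

  define A where "A = sqrt (\<Delta> * s * L) / sqrt (N * \<tau>)"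
  have A0: "0 \<le> A" using pos L \<Delta> by (simp add: A_def)
  have "(s * L * a)\<^sup>2 = s * L * \<Delta> / (3 * N * \<tau>)"
    unfolding power_mult_distrib a2 using pos L by (simp add: power2_eq_square)
  also have "\<dots> \<le> A\<^sup>2"
    using pos L \<Delta> by (simp add: A_def power_divide field_simps)
  finally have A: "s * L * a \<le> A" using A0 by (rule power2_le_imp_le)

  define W where "W = \<delta> ^ 2 * (s * L\<^sup>2 * \<Delta>\<^sup>2) powr (1/3) / (sqrt N * \<tau>) powr (2/3)"
  \<comment> \<open>Common size of the two terms balanced by \<open>b\<close>:
    \<open>\<Delta> / (N * \<tau> * b)\<close> equals \<open>1500 * z\<close>, and the quadratic
    noise term is at most \<open>46 * z\<close>.\<close>
  define z where "z = N * \<delta> ^ 6 * s * L\<^sup>2 * b\<^sup>2"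
  have W0: "0 \<le> W" by (simp add: W_def)
  have "((s * L\<^sup>2 * \<Delta>\<^sup>2) powr (1/3)) ^ 3 = s * L\<^sup>2 * \<Delta>\<^sup>2"
    using pos by (intro powr_third_cube) simp
  moreover have "((sqrt N * \<tau>) powr (2/3)) ^ 3 = N * \<tau>\<^sup>2"
    using pos by (subst powr_two_thirds_cube) (simp_all add: power_mult_distrib)
  ultimately have W3: "W ^ 3 = \<delta> ^ 6 * (s * L\<^sup>2 * \<Delta>\<^sup>2) / (N * \<tau>\<^sup>2)"
    by (simp add: W_def power_divide power_mult_distrib flip: power_mult)
  define K where "K = N\<^sup>2 * \<delta> ^ 6 * s * L\<^sup>2 * \<tau>"
  have "z ^ 3 * (N * \<tau>\<^sup>2) = (K * b ^ 3)\<^sup>2 * (\<delta> ^ 6 * (s * L\<^sup>2))"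
    unfolding z_def K_def by algebra
  moreover have "K * b ^ 3 = \<Delta> / 1500"
    using pos L by (simp add: b3 K_def)
  ultimately have "z ^ 3 * (N * \<tau>\<^sup>2) = \<delta> ^ 6 * (s * L\<^sup>2 * \<Delta>\<^sup>2) / 2250000"
    by (simp add: power_divide)
  then have "z ^ 3 = \<delta> ^ 6 * (s * L\<^sup>2 * \<Delta>\<^sup>2) / 2250000 / (N * \<tau>\<^sup>2)"
    using pos by (intro iffD2[OF nonzero_eq_divide_eq]) auto
  also have "\<dots> = \<delta> ^ 6 * (s * L\<^sup>2 * \<Delta>\<^sup>2) / (N * \<tau>\<^sup>2) / 2250000"
    by simp
  also have "\<dots> = W ^ 3 / 2250000" by (simp only: W3)
  \<comment> \<open>The cube of 125 is 1953125, below 2250000, the square of 1500.\<close>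
  also have "\<dots> \<le> (W / 125) ^ 3" using W0 by (simp add: power_divide)
  finally have "z ^ Suc 2 \<le> (W / 125) ^ Suc 2" by simp
  then have z: "z \<le> W / 125" by (rule power_le_imp_le_base) (use W0 in simp)

  have "7 / 10 * (1 / \<tau> * E) = (7 / 10 * (N\<^sup>2 * E)) / (N\<^sup>2 * \<tau>)"
    using pos by simp
  also have "\<dots> \<le> (N * \<Delta> / \<gamma> + 8 * N\<^sup>2 * \<delta>\<^sup>2 * L * \<Delta> + N * F0 / 5 +
       (46 * \<delta> * (\<gamma> * N * L * \<delta>)\<^sup>2 + L * \<gamma> * N) * (\<tau> * (N * s))) / (N\<^sup>2 * \<tau>)"
    using E pos unfolding N_def \<delta>_def s_def by (intro divide_right_mono) auto
  also have "\<dots> = \<Delta> / (N * \<tau>) * (1 / \<gamma>) + 8 * (\<delta>\<^sup>2 * (L * \<Delta> / \<tau>)) + F0 / (N * \<tau>) / 5 +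
      46 * (N * \<delta> ^ 3 * s * L\<^sup>2 * \<gamma>\<^sup>2) + s * L * \<gamma>"
  proof -
    have "N * \<Delta> / \<gamma> / (N\<^sup>2 * \<tau>) = \<Delta> / (N * \<tau>) * (1 / \<gamma>)"
      using pos \<gamma>0 by (simp add: power2_eq_square)
    moreover have "8 * N\<^sup>2 * \<delta>\<^sup>2 * L * \<Delta> / (N\<^sup>2 * \<tau>) = 8 * (\<delta>\<^sup>2 * (L * \<Delta> / \<tau>))"
      using pos by simp
    moreover have "N * F0 / 5 / (N\<^sup>2 * \<tau>) = F0 / (N * \<tau>) / 5"
      using pos by (simp add: power2_eq_square)
    moreover have "46 * \<delta> * (\<gamma> * N * L * \<delta>)\<^sup>2 * (\<tau> * (N * s)) / (N\<^sup>2 * \<tau>) =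
        46 * (N * \<delta> ^ 3 * s * L\<^sup>2 * \<gamma>\<^sup>2)"
      using pos by (simp add: power2_eq_square power3_eq_cube)
    moreover have "L * \<gamma> * N * (\<tau> * (N * s)) / (N\<^sup>2 * \<tau>) = s * L * \<gamma>"
      using pos by (simp add: power2_eq_square)
    ultimately show ?thesis by (simp only: add_divide_distrib distrib_right add.assoc)
  qed
  \<comment> \<open>Powers of \<open>\<delta>\<close> are raised only to match the other terms:
    \<open>\<delta> ^ 2\<close> to the cube coming from \<open>c\<close>, and
    \<open>\<delta> ^ 3\<close> to the sixth power built into \<open>b\<close>.\<close>
  also have "\<dots> \<le> \<Delta> / (N * \<tau>) * (1 / a + 1 / b + 1 / c) + 8 * (\<delta> ^ 3 * (L * \<Delta> / \<tau>)) + F0 / (N * \<tau>) / 5 +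
      46 * (N * \<delta> ^ 6 * s * L\<^sup>2 * b\<^sup>2) + s * L * a"
    using pos L \<Delta> inv \<gamma>0 \<gamma>a \<gamma>b
    by (intro add_mono mult_mono order_refl power_mono power_increasing mult_nonneg_nonneg) auto
  also have "\<dots> = 4 * (s * L * a) + 1546 * z + 108 * (\<delta> ^ 3 * (L * \<Delta> / \<tau>)) + F0 / (N * \<tau>) / 5"
  proof -
    have "\<Delta> / (N * \<tau>) * (1 / a) = 3 * (s * L * a)"
    proof -
      have "\<Delta> = 3 * s * L * N * \<tau> * a\<^sup>2" using a2 pos L by simp
      then show ?thesis using a0 pos by (simp add: power2_eq_square)
    qed
    moreover have "\<Delta> / (N * \<tau>) * (1 / b) = 1500 * z"
    proof -
      have "\<Delta> = 1500 * N ^ 2 * \<delta> ^ 6 * s * L\<^sup>2 * \<tau> * b ^ 3" using b3 pos L by simp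
      then show ?thesis using b0 pos by (simp add: z_def power2_eq_square power3_eq_cube)
    qed
    moreover have "\<Delta> / (N * \<tau>) * (1 / c) = 100 * (\<delta> ^ 3 * (L * \<Delta> / \<tau>))"
      using pos by (simp add: c_def)
    ultimately show ?thesis by (simp add: distrib_left z_def)
  qed
  \<comment> \<open>The coefficient 13 is \<open>1546 / 125\<close> rounded up. Division by
    \<open>7/10\<close> still leaves all four coefficients below 32, 240, 800 and 1.\<close>
  finally have main: "7 / 10 * (1 / \<tau> * E) \<le> 4 * A + 13 * W + 108 * (\<delta> ^ 3 * (L * \<Delta> / \<tau>)) + F0 / (N * \<tau>) / 5"
    using A z W0 by linarith
  have nonneg: "0 \<le> \<delta> ^ 3 * (L * \<Delta> / \<tau>)" "0 \<le> F0 / (N * \<tau>)"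
    using pos L \<Delta> F0 by simp_all
  have "\<epsilon> \<le> 32 * \<alpha> + 240 * \<omega> + 800 * \<eta> + \<phi>"
    if "7 / 10 * \<epsilon> \<le> 4 * \<alpha> + 13 * \<omega> + 108 * \<eta> + \<phi> / 5" "0 \<le> \<alpha>" "0 \<le> \<omega>" "0 \<le> \<eta>" "0 \<le> \<phi>"
    for \<epsilon> \<alpha> \<omega> \<eta> \<phi> :: real
    using that by linarith
  from this[OF main A0 W0 nonneg]
  have "1 / \<tau> * E \<le> 32 * A + 240 * W + 800 * (\<delta> ^ 3 * (L * \<Delta> / \<tau>)) + F0 / (N * \<tau>)" .
  then show ?thesis
    by (simp add: A_def W_def N_def \<delta>_def s_def mult.assoc)
qed

theorem theorem2p1:
  fixes n B d T :: nat
    and f :: "nat \<Rightarrow> real ^ 'p \<Rightarrow> real"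
    and g :: "nat \<Rightarrow> real ^ 'p \<Rightarrow> 's \<Rightarrow> real ^ 'p"
    and D :: "nat \<Rightarrow> 's measure"
    and M :: "'w measure"
    and \<xi> :: "nat \<Rightarrow> nat \<Rightarrow> 'w \<Rightarrow> 's"
    and x0 :: "real ^ 'p"
    and x :: "nat \<Rightarrow> nat \<Rightarrow> 'w \<Rightarrow> real ^ 'p"
    and L \<sigma> \<gamma> \<Delta> :: real
  assumes B: "B \<ge> 2" and n: "n \<ge> 2" and T: "T \<ge> 1"
    and d: "(real B ^ d - 1) / (real B - 1) < real n"
           "real n \<le> (real B ^ (d + 1) - 1) / (real B - 1)"
    and \<sigma>: "\<sigma>\<^sup>2 > 0" and L: "L > 0"
    and f_differentiable: "\<And>i y. i \<in> {1..n} \<Longrightarrow> f i differentiable (at y)"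
    and f_bounded_below: "\<And>i. i \<in> {1..n} \<Longrightarrow> bdd_below (range (f i))"
    and f_smooth: "\<And>i. i \<in> {1..n} \<Longrightarrow> L-lipschitz_on UNIV (gradient (f i))"
    and M: "prob_space M"
    and \<xi>_distr: "\<And>i t. i \<in> {1..n} \<Longrightarrow> distr M (D i) (\<xi> i t) = D i"
    and \<xi>_indep: "prob_space.indep_vars M (\<lambda>(i, t). D i) (\<lambda>(i, t). \<xi> i t) ({1..n} \<times> UNIV)"
    and g_measurable: "\<And>i. i \<in> {1..n} \<Longrightarrow>
          (\<lambda>(y, s). g i y s) \<in> borel_measurable (borel \<Otimes>\<^sub>M D i)"
    and g_unbiased: "\<And>i y. i \<in> {1..n} \<Longrightarrow>
          integrable (D i) (g i y) \<and> (\<integral>s. g i y s \<partial>D i) = gradient (f i) y"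
    and g_variance: "\<And>i y. i \<in> {1..n} \<Longrightarrow>
          integrable (D i) (\<lambda>s. (norm (g i y s - gradient (f i) y))\<^sup>2) \<and>
          (\<integral>s. (norm (g i y s - gradient (f i) y))\<^sup>2 \<partial>D i) \<le> \<sigma>\<^sup>2"
    and x: "\<And>i t \<omega>. x i t \<omega> = btppX n B \<gamma> g x0 (\<lambda>j u. \<xi> j u \<omega>) t i"
    and \<Delta>: "\<Delta> = avg_objective n f x0 - (INF y. avg_objective n f y)"
    and \<gamma>: "\<gamma> = Min {(\<Delta> / (3 * \<sigma>\<^sup>2 * L * real n * (real T + 1))) powr (1/2),
                     (\<Delta> / (1500 * real n ^ 2 * real d ^ 6 * \<sigma>\<^sup>2 * L\<^sup>2 * (real T + 1))) powr (1/3),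
                     1 / (100 * real n * real d ^ 3 * L)}"
  shows "(\<forall>t\<le>T. integrable M (\<lambda>\<omega>. (norm (gradient (avg_objective n f) (x 1 t \<omega>)))\<^sup>2)) \<and>
         1 / (real T + 1) *
           (\<Sum>t=0..T. \<integral>\<omega>. (norm (gradient (avg_objective n f) (x 1 t \<omega>)))\<^sup>2 \<partial>M)
         \<le> 32 * sqrt (\<Delta> * \<sigma>\<^sup>2 * L) / sqrt (real n * (real T + 1))
           + 240 * real d ^ 2 * (\<sigma>\<^sup>2 * L\<^sup>2 * \<Delta>\<^sup>2) powr (1/3)
               / (sqrt (real n) * (real T + 1)) powr (2/3)
           + 800 * real d ^ 3 * L * \<Delta> / (real T + 1)
           + (frobenius_norm n (\<lambda>i. gradient (f i) x0))\<^sup>2 / (real n * (real T + 1))"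
proof -
  define G where "G i = gradient (f i)" for i
  define F where "F = avg_objective n f"
  have n1: "n \<ge> 1" and B1: "B \<ge> 1" and B2: "B \<ge> 2" using n B by auto
  interpret prob_space M by (rule M)
  interpret btpp_sampling M n B \<gamma> L \<sigma> g G D \<xi> x0
    using B1 f_smooth \<xi>_distr \<xi>_indep g_measurable g_unbiased g_variance
    by unfold_locales (simp_all only: G_def)
  have x_eq: "x 1 t \<omega> = X (sample \<omega>) t 1" for t \<omega>
    by (simp add: x X_def)

  have F_deriv: "GDERIV F y :> (1 / real n) *\<^sub>R (\<Sum>i=1..n. G i y)" for y
    unfolding F_def G_def by (rule GDERIV_avg_objective) (rule f_differentiable)
  then have F_diff: "F differentiable (at y)" for y
    unfolding gderiv_def differentiable_def by blast
  have F_grad: "real n *\<^sub>R gradient F y = (\<Sum>i=1..n. G i y)" for y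
    using gradient_eqI[OF F_deriv, of y] n1 by simp
  have F_lip: "L-lipschitz_on UNIV (gradient F)"
    unfolding F_def by (rule lipschitz_gradient_avg_objective[OF f_differentiable n1 f_smooth])
  have "bdd_below (range F)"
  proof -
    obtain c where c: "\<And>i y. i \<in> {1..n} \<Longrightarrow> c i \<le> f i y"
      using f_bounded_below unfolding bdd_below_def by (metis rangeI)
    have "1 / real n * (\<Sum>i=1..n. c i) \<le> F y" for y
      unfolding F_def avg_objective_def by (intro mult_left_mono sum_mono c) auto
    then show ?thesis by (rule bdd_belowI2)
  qed
  then have low: "F x0 - \<Delta> \<le> F y" for y
    using cINF_lower[of F UNIV y] by (simp add: \<Delta> F_def)
  have \<Delta>0: "0 \<le> \<Delta>" using low[of x0] by simp
  have grad0: "(norm (gradient F x0))\<^sup>2 \<le> 2 * L * \<Delta>"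
    using norm_gradient_le_suboptimality[OF F_diff F_lip L low, of x0] by simp
  have F0: "(frobenius_norm n (\<lambda>i. gradient (f i) x0))\<^sup>2 = (\<Sum>i=1..n. (norm (G i x0))\<^sup>2)"
    by (simp add: frobenius_norm_def G_def norm_vec_def L2_set_def sum_nonneg)
  have int: "integrable M (\<lambda>\<omega>. (norm (gradient F (x 1 t \<omega>)))\<^sup>2)" for t
    unfolding x_eq using n1 by (intro sqint_integrable sqint_lipschitz[OF F_lip] sqint_X) simp
  have d1: "d \<ge> 1"
  proof (rule ccontr)
    assume "\<not> d \<ge> 1"
    then have "real n \<le> 1" using d(2) B2 by (cases "d = 0") auto
    then show False using n by simp
  qed

  show ?thesis
  proof (intro conjI allI impI)
    show "integrable M (\<lambda>\<omega>. (norm (gradient (avg_objective n f) (x 1 t \<omega>)))\<^sup>2)" for t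
      using int by (simp add: F_def)
    let ?E = "\<Sum>t=0..T. \<integral>\<omega>. (norm (gradient (avg_objective n f) (x 1 t \<omega>)))\<^sup>2 \<partial>M"
    let ?F0 = "(frobenius_norm n (\<lambda>i. gradient (f i) x0))\<^sup>2"
    show "1 / (real T + 1) * ?E
         \<le> 32 * sqrt (\<Delta> * \<sigma>\<^sup>2 * L) / sqrt (real n * (real T + 1))
           + 240 * real d ^ 2 * (\<sigma>\<^sup>2 * L\<^sup>2 * \<Delta>\<^sup>2) powr (1/3)
               / (sqrt (real n) * (real T + 1)) powr (2/3)
           + 800 * real d ^ 3 * L * \<Delta> / (real T + 1)
           + ?F0 / (real n * (real T + 1))"
    proof (cases "\<Delta> = 0")
      case True
      \<comment> \<open>Two candidates of the minimum vanish, so the iteration stands still at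
        \<open>x0\<close>, where \<open>grad0\<close> forces a zero gradient. The general bound
        divides by \<open>\<gamma>\<close> and does not cover this case.\<close>
      have \<gamma>0: "\<gamma> = 0" using L n1 by (simp add: \<gamma> True)
      have "btppX n B \<gamma> g x0 s t i = x0" if "i \<in> {1..n}" for s t i
        using that
      proof (induction t arbitrary: i)
        case (Suc t)
        have "btppX n B \<gamma> g x0 s (Suc t) i =
            btppX n B \<gamma> g x0 s t (parent B i) - \<gamma> *\<^sub>R btppY n B \<gamma> g x0 s t (parent B i)"
          by (rule btppX_Suc[OF B1 Suc.prems])
        then show ?case using Suc.IH[OF parent_in[OF Suc.prems, of B]] \<gamma>0 by simp
      qed simp
      then have "x 1 t \<omega> = x0" for t \<omega> using n1 by (simp add: x)
      moreover have "gradient F x0 = 0" using grad0 True by simp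
      ultimately have "?E = 0" by (simp add: F_def)
      then show ?thesis using True by simp
    next
      case False
      then have \<Delta>: "0 < \<Delta>" using \<Delta>0 by simp
      have \<gamma>0: "0 < \<gamma>" using \<Delta> \<sigma> L n1 d1 by (simp add: \<gamma>)
      have "\<gamma> \<le> 1 / (100 * real n * real d ^ 3 * L)" by (simp add: \<gamma>)
      then have step: "100 * real n * real d ^ 3 * L * \<gamma> \<le> 1"
        using L n1 d1 by (simp add: field_simps)
      have depth: "depth B i \<le> d" if "i \<in> {1..n}" for i
        using that d(2) by (intro depth_le_of_le_geometric[OF B2]) auto
      have "7 / 10 * ((real n)\<^sup>2 * (\<Sum>t\<le>T. \<integral>\<omega>. (norm (gradient F (X (sample \<omega>) t 1)))\<^sup>2 \<partial>M)) \<le>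
          real n * \<Delta> / \<gamma> + 8 * (real n)\<^sup>2 * (real d)\<^sup>2 * L * \<Delta> +
          real n * (\<Sum>i=1..n. (norm (G i x0))\<^sup>2) / 5 +
          (46 * real d * (\<gamma> * real n * L * real d)\<^sup>2 + L * \<gamma> * real n) * (real (Suc T) * (real n * \<sigma>\<^sup>2))"
        by (rule expected_bound[OF n1 d1 L \<gamma>0 depth step F_grad smooth_upper_bound[OF F_diff F_lip] F_lip low grad0])
      then have "7 / 10 * ((real n)\<^sup>2 * ?E) \<le>
          real n * \<Delta> / \<gamma> + 8 * (real n)\<^sup>2 * (real d)\<^sup>2 * L * \<Delta> + real n * ?F0 / 5 +
          (46 * real d * (\<gamma> * real n * L * real d)\<^sup>2 + L * \<gamma> * real n) * ((real T + 1) * (real n * \<sigma>\<^sup>2))"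
        unfolding F0 F_def x_eq atLeast0AtMost by (simp add: add.commute)
      then show ?thesis
        by (rule stepsize_bound[OF n1 d1 L \<sigma> \<Delta> _ \<gamma>, rotated]) simp
    qed
  qed
qed

end
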